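(* Let $k\ge 1$ be an integer and let $T$ be a balanced tree on $2k$ or $2k+1$ vertices such that the Erdős–Sós conjecture holds for every subtree of $T$, i.e. for every subtree $T'$ of $T$ and every $m$, every $m$-vertex graph with more than $\frac{|T'|-2}{2}m$ edges contains a copy of $T'$. Then for every $n\ge 4(4k)^6$, $$\mathrm{ex}(n,\widehat{T})\le f(n,k),\qquad\text{where } f(n,k)=\max\left\{n_0n_1+\left\lfloor\frac{(k-1)n_0}{2}\right\rfloor:\ n_0+n_1=n\right\}$$ (maximum over nonnegative integers $n_0,n_1$). Moreover, equality $\mathrm{ex}(n,\widehat{T})=f(n,k)$ holds for infinitely many $n$.
   Context: $\mathrm{ex}(n,H)$ denotes the maximum number of edges of an $n$-vertex graph containing no subgraph isomorphic to $H$. For a graph $H$, the suspension $\widehat{H}$ is the graph obtained from $H$ by adding a new vertex adjacent to all vertices of $H$. A tree is balanced if the sizes of its two color classes (in its proper 2-coloring) differ by at most $1$. $|T|$ denotes the number of vertices of $T$. *)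

theory Defs
  imports
    Complex_Main
    "Graph_Theory.Pair_Digraph"
    "Graph_Theory.Digraph_Component"
    "Graph_Theory.Digraph_Isomorphism"
begin

text \<open>
  A finite simple graph is a \<^locale>\<open>pair_graph\<close>: a finite vertex set with a symmetric irreflexive
  set of arcs. An undirected edge uv is thus present as both (u,v) and (v,u), so edges have to be
  counted as unordered pairs.
\<close>

definition edges :: "'a pair_pre_digraph \<Rightarrow> 'a set set" where
  "edges G = {{u, v} | u v. (u, v) \<in> parcs G}"

definition contains_copy :: "'b pair_pre_digraph \<Rightarrow> 'a pair_pre_digraph \<Rightarrow> bool" where
  "contains_copy G H \<longleftrightarrow>
     (\<exists>G'. subgraph (with_proj G') (with_proj G) \<and> digraph_iso (with_proj H) (with_proj G'))"

text \<open>
  \<^const>\<open>tree\<close> from the digraph library cannot be used: in a symmetric digraph every edge yields a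
  directed cycle of length 2, so a tree with an edge would not count as a forest. The cycles of the
  undirected graph are the directed ones of length at least 3.
\<close>

definition undirected_tree :: "'a pair_pre_digraph \<Rightarrow> bool" where
  "undirected_tree T \<longleftrightarrow>
     pair_graph T \<and> Digraph_Component.connected (with_proj T) \<and>
     \<not> (\<exists>p. pre_digraph.cycle (with_proj T) p \<and> length p \<ge> 3)"

definition proper_2_coloring :: "'a pair_pre_digraph \<Rightarrow> 'a set \<Rightarrow> 'a set \<Rightarrow> bool" where
  "proper_2_coloring G A B \<longleftrightarrow>
     A \<union> B = pverts G \<and> A \<inter> B = {} \<and>
     (\<forall>(u, v) \<in> parcs G. u \<in> A \<and> v \<in> B \<or> u \<in> B \<and> v \<in> A)"

text \<open>
  The proper 2-coloring of a tree is unique up to exchanging the two classes, so it does not matter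
  that the coloring is quantified existentially.
\<close>

definition balanced_tree :: "'a pair_pre_digraph \<Rightarrow> bool" where
  "balanced_tree T \<longleftrightarrow>
     undirected_tree T \<and>
     (\<exists>A B. proper_2_coloring T A B \<and> \<bar>int (card A) - int (card B)\<bar> \<le> 1)"

text \<open>The new vertex of the suspension is \<^const>\<open>None\<close>.\<close>

definition suspension :: "'a pair_pre_digraph \<Rightarrow> 'a option pair_pre_digraph" where
  "suspension H =
     \<lparr> pverts = insert None (Some ` pverts H),
       parcs = {(Some u, Some v) | u v. (u, v) \<in> parcs H}
               \<union> {(None, Some v) | v. v \<in> pverts H}
               \<union> {(Some v, None) | v. v \<in> pverts H} \<rparr>"

text \<open>
  Host graphs have natural numbers as vertices; every finite graph is isomorphic to such a graph.
  The factor (|T| - 2)/2 is a real number, negative for the one-vertex tree.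
\<close>

definition erdos_sos_holds :: "'a pair_pre_digraph \<Rightarrow> bool" where
  "erdos_sos_holds T \<longleftrightarrow>
     (\<forall>m. \<forall>G :: nat pair_pre_digraph.
        pair_graph G \<and> card (pverts G) = m \<and>
        real (card (edges G)) > (real (card (pverts T)) - 2) / 2 * real m
        \<longrightarrow> contains_copy G T)"

text \<open>
  The set below is finite, and it is nonempty as soon as \<open>H\<close> has an edge
  (\<open>finite_ex_set\<close> and \<open>ex_set_nonempty\<close> below).
\<close>

definition ex_number :: "nat \<Rightarrow> 'a pair_pre_digraph \<Rightarrow> nat" where
  "ex_number n H = Max {card (edges G) | G :: nat pair_pre_digraph.
                   pair_graph G \<and> card (pverts G) = n \<and> \<not> contains_copy G H}"

definition f_bound :: "nat \<Rightarrow> nat \<Rightarrow> nat" where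
  "f_bound n k = Max {n\<^sub>0 * n\<^sub>1 + ((k - 1) * n\<^sub>0) div 2 | n\<^sub>0 n\<^sub>1. n\<^sub>0 + n\<^sub>1 = n}"

lemma pair_graph_iff:
  "pair_graph G \<longleftrightarrow> finite (pverts G) \<and> parcs G \<subseteq> pverts G \<times> pverts G \<and> sym (parcs G) \<and> irrefl (parcs G)"
proof
  assume "pair_graph G"
  then interpret pair_graph G .
  show "finite (pverts G) \<and> parcs G \<subseteq> pverts G \<times> pverts G \<and> sym (parcs G) \<and> irrefl (parcs G)"
    using pair_finite_verts pair_sym_arcs pair_no_loops
    by (fastforce simp: symmetric_def irrefl_def dest: arc_fst_in_verts arc_snd_in_verts)
next
  assume *: "finite (pverts G) \<and> parcs G \<subseteq> pverts G \<times> pverts G \<and> sym (parcs G) \<and> irrefl (parcs G)"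
  then have "finite (parcs G)" by (meson finite_SigmaI finite_subset)
  with * show "pair_graph G"
    by unfold_locales (auto simp: symmetric_def irrefl_def)
qed

lemma contains_copy_iff:
  assumes "pair_graph G" "pair_graph H"
  shows "contains_copy G H \<longleftrightarrow>
    (\<exists>h. inj_on h (pverts H) \<and> h ` pverts H \<subseteq> pverts G \<and> (\<forall>(u, v) \<in> parcs H. (h u, h v) \<in> parcs G))"
    (is "_ \<longleftrightarrow> ?R")
proof
  interpret G: pair_graph G by fact
  interpret H: pair_graph H by fact
  assume "contains_copy G H"
  then obtain G' i where s: "subgraph (with_proj G') (with_proj G)"
    and i: "pre_digraph.digraph_isomorphism (with_proj H) i" "with_proj G' = app_iso i (with_proj H)"
    by (auto simp: contains_copy_def digraph_iso_def)
  have V: "pverts G' = iso_verts i ` pverts H" and E: "parcs G' = iso_arcs i ` parcs H"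
    and t: "iso_tail i = fst" and h: "iso_head i = snd"
    using i(2) by (auto simp: with_proj_def app_iso_def)
  have "inj_on (iso_verts i) (pverts H)"
    and "\<forall>(u, v) \<in> parcs H. iso_arcs i (u, v) = (iso_verts i u, iso_verts i v)"
    using i(1) t h by (auto simp: pre_digraph.digraph_isomorphism_def prod_eq_iff)
  moreover have "pverts G' \<subseteq> pverts G" "parcs G' \<subseteq> parcs G"
    using s by (auto simp: subgraph_def)
  ultimately show ?R using V E by (intro exI[of _ "iso_verts i"]) force
next
  interpret G: pair_graph G by fact
  interpret H: pair_graph H by fact
  assume ?R
  then obtain h where h: "inj_on h (pverts H)" "h ` pverts H \<subseteq> pverts G"
    "\<forall>(u, v) \<in> parcs H. (h u, h v) \<in> parcs G" by blast
  define i where "i = \<lparr>iso_verts = h, iso_arcs = map_prod h h, iso_head = snd, iso_tail = fst\<rparr>"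
  define G' where "G' = \<lparr>pverts = h ` pverts H, parcs = map_prod h h ` parcs H\<rparr>"
  have sub: "parcs H \<subseteq> pverts H \<times> pverts H"
    using assms(2) by (simp add: pair_graph_iff)
  then have "inj_on (map_prod h h) (parcs H)"
    using map_prod_inj_on[OF h(1) h(1)] inj_on_subset by blast
  then have "pre_digraph.digraph_isomorphism (with_proj H) i"
    using h(1) H.wf_digraph by (simp add: pre_digraph.digraph_isomorphism_def i_def)
  moreover have "with_proj G' = app_iso i (with_proj H)"
    by (simp add: with_proj_def app_iso_def G'_def i_def)
  moreover have "pair_wf_digraph G'"
    using sub by (unfold_locales) (auto simp: G'_def)
  then have "wf_digraph (with_proj G')"
    by (simp add: wf_digraph_wp_iff)
  then have "subgraph (with_proj G') (with_proj G)"
    using h(2,3) G.wf_digraph by (auto simp: subgraph_def compatible_def G'_def)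
  ultimately show "contains_copy G H"
    unfolding contains_copy_def digraph_iso_def by blast
qed

lemma pair_graph_suspension: "pair_graph H \<Longrightarrow> pair_graph (suspension H)"
  by (auto simp: pair_graph_iff suspension_def sym_def irrefl_def)

lemma finite_ex_set:
  "finite {card (edges G) | G :: nat pair_pre_digraph.
             pair_graph G \<and> card (pverts G) = n \<and> \<not> contains_copy G H}"
proof (rule finite_subset)
  show "{card (edges G) | G :: nat pair_pre_digraph.
          pair_graph G \<and> card (pverts G) = n \<and> \<not> contains_copy G H} \<subseteq> {..2 ^ n}"
  proof clarsimp
    fix G :: "nat pair_pre_digraph"
    assume "pair_graph G"
    then have "edges G \<subseteq> Pow (pverts G)" "finite (pverts G)"
      by (auto simp: edges_def pair_graph_iff)
    then show "card (edges G) \<le> 2 ^ card (pverts G)"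
      by (metis card_Pow card_mono finite_Pow_iff)
  qed
qed simp

lemma ex_set_nonempty:
  assumes "pair_graph H" "parcs H \<noteq> {}"
  shows "{card (edges G) | G :: nat pair_pre_digraph.
           pair_graph G \<and> card (pverts G) = n \<and> \<not> contains_copy G H} \<noteq> {}"
proof -
  let ?G = "\<lparr>pverts = {..<n}, parcs = {}\<rparr>"
  have "pair_graph ?G" by (simp add: pair_graph_iff sym_def)
  moreover have "\<not> contains_copy ?G H"
    using assms by (auto simp: contains_copy_iff[OF \<open>pair_graph ?G\<close> assms(1)])
  ultimately show ?thesis by fastforce
qed

end

theory Submission
  imports Defs
begin

text \<open>
  Upper bound. The neighbourhood of a vertex \<open>v\<close> contains no copy of \<open>T\<close>, so by the Erdos-Sos bound it
  spans at most \<open>(k - 1/2) deg v\<close> edges. Splitting along the neighbourhood of a vertex of maximum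
  degree therefore shows that a graph with at least \<open>n\<^sup>2/4\<close> edges is bipartite up to \<open>O(k n)\<close> edges.
  In a maximum cut all but \<open>O(k\<^sup>3)\<close> vertices are joined to almost all of the other side, and the
  exceptional vertices have degree well below \<open>n/2\<close>, so they can be discarded. On the rest, a vertex
  with \<open>a \<ge> 1\<close> neighbours on its own side forces the other side to have average degree at most
  \<open>k - a - 1/2\<close>, because of the following fact: for \<open>a + b = k\<close>, \<open>a \<ge> 1\<close>, a tree with at most
  \<open>2 k + 1\<close> vertices has an independent set \<open>D\<close> of at most \<open>a\<close> vertices whose removal leaves components
  of at most \<open>b + 1\<close> vertices. These components are embedded one by one with the Erdos-Sos bound for
  subtrees into the common neighbourhood of \<open>a\<close> neighbours of \<open>v\<close>, which themselves host \<open>D\<close>.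

  To find \<open>D\<close>, either some vertex leaves only branches of at most \<open>b\<close> vertices, or some edge separates
  two parts of at least \<open>b + 1\<close> vertices each. In the second case each part has two cuts, one containing
  and one avoiding the end of the edge, of total size at most its number of vertices minus \<open>b\<close>;
  combining them crosswise gives two cuts of the tree, and the smaller one is good enough.

  Lower bound. Put disjoint copies of \<open>K\<^bsub>k-1,k-1\<^esub>\<close> into one side of a complete bipartite graph. Both
  color classes of \<open>T\<close> have at least \<open>k\<close> vertices, whereas a neighbourhood is either complete bipartite with
  a class of \<open>k - 1\<close> vertices or has components of only \<open>2 k - 2\<close> vertices.
\<close>

section \<open>Cutting a tree into small pieces\<close>

text \<open>Two disjoint trees are joined by an edge between their roots, and the first root
  survives. Inductions thus face two parts and one new edge instead of a list of branches.\<close>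

inductive rtree :: "'a set \<Rightarrow> ('a \<times> 'a) set \<Rightarrow> 'a \<Rightarrow> bool" where
  single: "rtree {r} {} r"
| glue: "rtree V\<^sub>1 E\<^sub>1 r\<^sub>1 \<Longrightarrow> rtree V\<^sub>2 E\<^sub>2 r\<^sub>2 \<Longrightarrow> V\<^sub>1 \<inter> V\<^sub>2 = {} \<Longrightarrow>
    rtree (V\<^sub>1 \<union> V\<^sub>2) (E\<^sub>1 \<union> E\<^sub>2 \<union> {(r\<^sub>1, r\<^sub>2), (r\<^sub>2, r\<^sub>1)}) r\<^sub>1"

lemma rtree_finite: "rtree V E r \<Longrightarrow> finite V"
  by (induction rule: rtree.induct) auto

lemma rtree_root: "rtree V E r \<Longrightarrow> r \<in> V"
  by (induction rule: rtree.induct) auto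

lemma rtree_edges: "rtree V E r \<Longrightarrow> E \<subseteq> V \<times> V"
  by (induction rule: rtree.induct) (auto dest: rtree_root)

lemma rtree_irrefl: "rtree V E r \<Longrightarrow> (x, x) \<notin> E"
  by (induction rule: rtree.induct) (auto dest: rtree_root)

text \<open>The induction descends into the part containing \<open>p\<close> until \<open>p\<close>
  is a root. This frees gluing from the roots: leaves can be added anywhere, and the old root is
  kept.\<close>

lemma rtree_attach:
  assumes "rtree V E r" "rtree W F w" "V \<inter> W = {}" "p \<in> V"
  shows "rtree (V \<union> W) (E \<union> F \<union> {(p, w), (w, p)}) r"
  using assms
proof (induction arbitrary: p rule: rtree.induct)
  case (single r)
  then show ?case using rtree.glue[OF rtree.single[of r] single(1)] by simp
next
  case (glue V1 E1 r1 V2 E2 r2)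
  consider "p \<in> V1" | "p \<in> V2" using glue.prems by blast
  then show ?case
  proof cases
    case 1
    then have r: "rtree (V1 \<union> W) (E1 \<union> F \<union> {(p, w), (w, p)}) r1"
      using glue by (intro glue.IH(1)) auto
    have "(V1 \<union> W) \<inter> V2 = {}" using glue.hyps glue.prems by blast
    from rtree.glue[OF r glue.hyps(2) this] show ?thesis by (simp add: Un_ac insert_commute)
  next
    case 2
    then have r: "rtree (V2 \<union> W) (E2 \<union> F \<union> {(p, w), (w, p)}) r2"
      using glue by (intro glue.IH(2)) auto
    have "V1 \<inter> (V2 \<union> W) = {}" using glue.hyps glue.prems by blast
    from rtree.glue[OF glue.hyps(1) r this] show ?thesis by (simp add: Un_ac insert_commute)
  qed
qed

text \<open>
  Removing \<open>D\<close> leaves no edge between different fibres of the labelling \<open>g\<close>, so every component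
  of the rest has at most \<open>s\<close> vertices. The fibres themselves need not be connected, which makes
  glueing two cuts trivial.
\<close>

definition vertex_cut :: "'a set \<Rightarrow> ('a \<times> 'a) set \<Rightarrow> 'a set \<Rightarrow> nat \<Rightarrow> bool" where
  "vertex_cut V E D s \<longleftrightarrow> D \<subseteq> V \<and> E \<inter> D \<times> D = {} \<and>
     (\<exists>g. g ` (V - D) \<subseteq> V \<and> (\<forall>x y. (x, y) \<in> E \<longrightarrow> x \<in> D \<or> y \<in> D \<or> g x = g y) \<and>
          (\<forall>c. card {x \<in> V - D. g x = c} \<le> s))"

lemma vertex_cut_mono: "vertex_cut V E D s \<Longrightarrow> s \<le> t \<Longrightarrow> vertex_cut V E D t"
  unfolding vertex_cut_def by (meson le_trans)

text \<open>One common label suffices once at most \<open>s\<close> vertices remain.\<close>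

lemma vertex_cut_const:
  assumes "finite V" "V \<noteq> {}" "D \<subseteq> V" "E \<inter> D \<times> D = {}" "card (V - D) \<le> s"
  shows "vertex_cut V E D s"
proof -
  obtain v where "v \<in> V" using assms by blast
  moreover have "card {x \<in> V - D. v = c} \<le> s" for c
    using card_mono[OF finite_Diff[OF assms(1)], of "{x \<in> V - D. v = c}" D] assms(5) by fastforce
  ultimately show ?thesis
    using assms unfolding vertex_cut_def by (intro conjI exI[of _ "\<lambda>_. v"]) auto
qed

text \<open>The new edge has exactly one end in the union of the cuts, so it is covered and the
  union stays independent.\<close>

lemma vertex_cut_glue:
  assumes "vertex_cut V\<^sub>1 E\<^sub>1 D\<^sub>1 s" "vertex_cut V\<^sub>2 E\<^sub>2 D\<^sub>2 s" "V\<^sub>1 \<inter> V\<^sub>2 = {}" "E\<^sub>1 \<subseteq> V\<^sub>1 \<times> V\<^sub>1" "E\<^sub>2 \<subseteq> V\<^sub>2 \<times> V\<^sub>2"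
    and "p \<in> V\<^sub>1" "q \<in> V\<^sub>2" "p \<in> D\<^sub>1 \<longleftrightarrow> q \<notin> D\<^sub>2"
  shows "vertex_cut (V\<^sub>1 \<union> V\<^sub>2) (E\<^sub>1 \<union> E\<^sub>2 \<union> {(p, q), (q, p)}) (D\<^sub>1 \<union> D\<^sub>2) s"
proof -
  obtain g where g: "g ` (V\<^sub>1 - D\<^sub>1) \<subseteq> V\<^sub>1" "\<forall>x y. (x, y) \<in> E\<^sub>1 \<longrightarrow> x \<in> D\<^sub>1 \<or> y \<in> D\<^sub>1 \<or> g x = g y"
    "\<And>c. card {x \<in> V\<^sub>1 - D\<^sub>1. g x = c} \<le> s" and D1: "D\<^sub>1 \<subseteq> V\<^sub>1" "E\<^sub>1 \<inter> D\<^sub>1 \<times> D\<^sub>1 = {}"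
    using assms(1) unfolding vertex_cut_def by blast
  obtain h where h: "h ` (V\<^sub>2 - D\<^sub>2) \<subseteq> V\<^sub>2" "\<forall>x y. (x, y) \<in> E\<^sub>2 \<longrightarrow> x \<in> D\<^sub>2 \<or> y \<in> D\<^sub>2 \<or> h x = h y"
    "\<And>c. card {x \<in> V\<^sub>2 - D\<^sub>2. h x = c} \<le> s" and D2: "D\<^sub>2 \<subseteq> V\<^sub>2" "E\<^sub>2 \<inter> D\<^sub>2 \<times> D\<^sub>2 = {}"
    using assms(2) unfolding vertex_cut_def by blast
  \<comment> \<open>Labels of each part lie in that part, so fibres of \<open>g\<close> and
    \<open>h\<close> never merge.\<close>
  let ?f = "\<lambda>x. if x \<in> V\<^sub>1 then g x else h x"
  have "card {x \<in> V\<^sub>1 \<union> V\<^sub>2 - (D\<^sub>1 \<union> D\<^sub>2). ?f x = c} \<le> s" for c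
  proof (cases "c \<in> V\<^sub>1")
    case True
    then have "{x \<in> V\<^sub>1 \<union> V\<^sub>2 - (D\<^sub>1 \<union> D\<^sub>2). ?f x = c} = {x \<in> V\<^sub>1 - D\<^sub>1. g x = c}"
      using h(1) D2 assms(3) by (auto simp: image_subset_iff disjoint_iff subset_iff)
    then show ?thesis using g(3) by simp
  next
    case False
    then have "{x \<in> V\<^sub>1 \<union> V\<^sub>2 - (D\<^sub>1 \<union> D\<^sub>2). ?f x = c} = {x \<in> V\<^sub>2 - D\<^sub>2. h x = c}"
      using g(1) D1 assms(3) by (auto simp: image_subset_iff disjoint_iff subset_iff)
    then show ?thesis using h(3) by simp
  qed
  moreover have "?f ` (V\<^sub>1 \<union> V\<^sub>2 - (D\<^sub>1 \<union> D\<^sub>2)) \<subseteq> V\<^sub>1 \<union> V\<^sub>2"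
    using g(1) h(1) by auto
  moreover have c: "x \<in> D\<^sub>1 \<union> D\<^sub>2 \<or> y \<in> D\<^sub>1 \<union> D\<^sub>2 \<or> ?f x = ?f y"
    if e: "(x, y) \<in> E\<^sub>1 \<union> E\<^sub>2 \<union> {(p, q), (q, p)}" for x y
  proof -
    consider "(x, y) \<in> E\<^sub>1" | "(x, y) \<in> E\<^sub>2" | "(x, y) \<in> {(p, q), (q, p)}"
      using e by (elim UnE)
    then show ?thesis
    proof cases
      case 1
      then have "x \<in> V\<^sub>1" "y \<in> V\<^sub>1" using assms(4) by auto
      then show ?thesis using g(2) 1 by auto
    next
      case 2
      then have "x \<notin> V\<^sub>1" "y \<notin> V\<^sub>1" using assms(3,5) by auto
      then show ?thesis using h(2) 2 by auto
    qed (use assms(8) in auto)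
  qed
  moreover have "(E\<^sub>1 \<union> E\<^sub>2 \<union> {(p, q), (q, p)}) \<inter> (D\<^sub>1 \<union> D\<^sub>2) \<times> (D\<^sub>1 \<union> D\<^sub>2) = {}"
    using D1 D2 assms(3-8) by blast
  moreover have "D\<^sub>1 \<union> D\<^sub>2 \<subseteq> V\<^sub>1 \<union> V\<^sub>2" using D1(1) D2(1) by blast
  ultimately show ?thesis
    unfolding vertex_cut_def by (intro conjI exI[of _ ?f] allI impI c)
qed

text \<open>These cuts are the two color classes: each is independent and leaves only isolated
  vertices. Gluing combines the class through one root with the class avoiding the other.\<close>

lemma rtree_bipartition:
  assumes "rtree V E r"
  shows "\<exists>D D'. vertex_cut V E D 1 \<and> r \<notin> D \<and> vertex_cut V E D' 1 \<and> r \<in> D'"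
  using assms
proof (induction rule: rtree.induct)
  case (single r)
  have "vertex_cut {r} {} {} 1" "vertex_cut {r} {} {r} 1" by (auto intro!: vertex_cut_const)
  then show ?case by blast
next
  case (glue V1 E1 r1 V2 E2 r2)
  obtain D D' where D: "vertex_cut V1 E1 D 1" "r1 \<notin> D" "vertex_cut V1 E1 D' 1" "r1 \<in> D'" using glue.IH by blast
  obtain C C' where C: "vertex_cut V2 E2 C 1" "r2 \<notin> C" "vertex_cut V2 E2 C' 1" "r2 \<in> C'" using glue.IH by blast
  note gl = vertex_cut_glue[OF _ _ glue.hyps(3) rtree_edges[OF glue.hyps(1)] rtree_edges[OF glue.hyps(2)]
    rtree_root[OF glue.hyps(1)] rtree_root[OF glue.hyps(2)]]
  have "r1 \<notin> C'" using C(3) glue.hyps(3) rtree_root[OF glue.hyps(1)] by (auto simp: vertex_cut_def)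
  moreover have "vertex_cut (V1 \<union> V2) (E1 \<union> E2 \<union> {(r1, r2), (r2, r1)}) (D \<union> C') 1"
    "vertex_cut (V1 \<union> V2) (E1 \<union> E2 \<union> {(r1, r2), (r2, r1)}) (D' \<union> C) 1"
    using gl D C by auto
  ultimately show ?case using D by (metis Un_iff)
qed

text \<open>If the part of the root has at least \<open>s\<close> vertices, the induction continues
  there and the other part loses the color class through its root. Otherwise the whole part of the
  root is kept and joins the component of \<open>r2\<close>, for which a capacity of
  \<open>s - card V1\<close> remains.\<close>

lemma rtree_peel:
  assumes "rtree V E r" "1 \<le> s" "s \<le> card V"
  shows "\<exists>D. vertex_cut V E D s \<and> r \<notin> D \<and> card D + s \<le> card V"
  using assms
proof (induction arbitrary: s rule: rtree.induct)
  case (single r)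
  then have "s = 1" by simp
  moreover have "vertex_cut {r} {} {} 1" by (auto intro!: vertex_cut_const)
  ultimately show ?case by (intro exI[of _ "{}"]) auto
next
  case (glue V1 E1 r1 V2 E2 r2)
  note fin = rtree_finite[OF glue.hyps(1)] rtree_finite[OF glue.hyps(2)]
  note root = rtree_root[OF glue.hyps(1)] rtree_root[OF glue.hyps(2)]
  note ed = rtree_edges[OF glue.hyps(1)] rtree_edges[OF glue.hyps(2)]
  have cV: "card (V1 \<union> V2) = card V1 + card V2"
    using fin glue.hyps(3) by (rule card_Un_disjoint)
  show ?case
  proof (cases "s \<le> card V1")
    case True
    obtain D where D: "vertex_cut V1 E1 D s" "r1 \<notin> D" "card D + s \<le> card V1"
      using glue.IH(1)[OF glue.prems(1) True] by blast
    obtain C where C: "vertex_cut V2 E2 C 1" "r2 \<in> C" using rtree_bipartition[OF glue.hyps(2)] by blast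
    have "vertex_cut V2 E2 C s" using vertex_cut_mono[OF C(1) glue.prems(1)] .
    then have "vertex_cut (V1 \<union> V2) (E1 \<union> E2 \<union> {(r1, r2), (r2, r1)}) (D \<union> C) s"
      using vertex_cut_glue[OF D(1) _ glue.hyps(3) ed root] D(2) C(2) by blast
    moreover have CV: "C \<subseteq> V2" using C(1) by (simp add: vertex_cut_def)
    moreover have "card (D \<union> C) \<le> card D + card V2"
      using card_Un_le[of D C] card_mono[OF fin(2) CV] by linarith
    moreover have "r1 \<notin> D \<union> C" using D(2) CV root glue.hyps(3) by blast
    ultimately show ?thesis using D(3) cV by (intro exI[of _ "D \<union> C"]) linarith
  next
    case False
    then have "1 \<le> s - card V1" "s - card V1 \<le> card V2" using glue.prems cV by auto
    then obtain D where D: "vertex_cut V2 E2 D (s - card V1)" "r2 \<notin> D" "card D + (s - card V1) \<le> card V2"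
      using glue.IH(2) by blast
    obtain g where g: "g ` (V2 - D) \<subseteq> V2" "\<forall>x y. (x, y) \<in> E2 \<longrightarrow> x \<in> D \<or> y \<in> D \<or> g x = g y"
      "\<And>c. card {x \<in> V2 - D. g x = c} \<le> s - card V1" and DV: "D \<subseteq> V2" "E2 \<inter> D \<times> D = {}"
      using D(1) unfolding vertex_cut_def by blast
    \<comment> \<open>All of \<open>V1\<close> enters the fibre of \<open>r2\<close>, the other end
      of the new edge.\<close>
    let ?f = "\<lambda>x. if x \<in> V1 then g r2 else g x"
    have "card {x \<in> V1 \<union> V2 - D. ?f x = c} \<le> s" for c
    proof -
      have "{x \<in> V1 \<union> V2 - D. ?f x = c} \<subseteq> V1 \<union> {x \<in> V2 - D. g x = c}" by auto
      then have "card {x \<in> V1 \<union> V2 - D. ?f x = c} \<le> card (V1 \<union> {x \<in> V2 - D. g x = c})"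
        using fin by (intro card_mono) auto
      also have "\<dots> \<le> card V1 + (s - card V1)"
        using card_Un_le[of V1 "{x \<in> V2 - D. g x = c}"] g(3)[of c] by linarith
      finally show ?thesis using False by simp
    qed
    moreover have "?f ` (V1 \<union> V2 - D) \<subseteq> V1 \<union> V2" using g(1) D(2) root by auto
    moreover have f: "x \<in> D \<or> y \<in> D \<or> ?f x = ?f y"
      if e: "(x, y) \<in> E1 \<union> E2 \<union> {(r1, r2), (r2, r1)}" for x y
    proof -
      consider "(x, y) \<in> E1" | "(x, y) \<in> E2" | "(x, y) \<in> {(r1, r2), (r2, r1)}"
        using e by (elim UnE)
      then show ?thesis
      proof cases
        case 2
        then have "x \<notin> V1" "y \<notin> V1" using ed glue.hyps(3) by auto
        then show ?thesis using g(2) 2 by auto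
      next
        case 3
        have "r2 \<notin> V1" using root glue.hyps(3) by auto
        then show ?thesis using 3 root by auto
      qed (use ed in auto)
    qed
    moreover have "(E1 \<union> E2 \<union> {(r1, r2), (r2, r1)}) \<inter> D \<times> D = {}"
      using DV ed D(2) glue.hyps(3) by blast
    ultimately have "vertex_cut (V1 \<union> V2) (E1 \<union> E2 \<union> {(r1, r2), (r2, r1)}) D s"
      using DV(1) unfolding vertex_cut_def by (intro conjI exI[of _ ?f] allI impI f) auto
    moreover have "r1 \<notin> D" using DV(1) root glue.hyps(3) by blast
    ultimately show ?thesis using D(3) False cV by (intro exI[of _ D]) auto
  qed
qed

text \<open>
  Bounding the sum of two complementary cuts, instead of each of them, is what allows to glue: the cut
  containing the root of one part is combined with the cut avoiding the root of the other.
\<close>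

lemma rtree_cut_pair:
  assumes "rtree V E r"
  shows "\<exists>D D'. vertex_cut V E D (b + 1) \<and> r \<notin> D \<and> vertex_cut V E D' (b + 1) \<and> r \<in> D' \<and>
           card D + card D' \<le> max (card V - b) 1"
  using assms
proof (induction rule: rtree.induct)
  case (single r)
  have "vertex_cut {r} {} {} (b + 1)" "vertex_cut {r} {} {r} (b + 1)" by (auto intro!: vertex_cut_const)
  then show ?case by - (rule exI[of _ "{}"], rule exI[of _ "{r}"], auto)
next
  case (glue V1 E1 r1 V2 E2 r2)
  let ?E = "E1 \<union> E2 \<union> {(r1, r2), (r2, r1)}"
  note fin = rtree_finite[OF glue.hyps(1)] rtree_finite[OF glue.hyps(2)]
  note root = rtree_root[OF glue.hyps(1)] rtree_root[OF glue.hyps(2)]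
  note ed = rtree_edges[OF glue.hyps(1)] rtree_edges[OF glue.hyps(2)]
  have cV: "card (V1 \<union> V2) = card V1 + card V2"
    using fin glue.hyps(3) by (rule card_Un_disjoint)
  have pos: "card V1 > 0" "card V2 > 0" using fin root by (auto simp: card_gt_0_iff)
  show ?case
  proof (cases "b + 1 \<le> card V1 \<or> b + 1 \<le> card V2")
    case True
    obtain D D' where D: "vertex_cut V1 E1 D (b + 1)" "r1 \<notin> D" "vertex_cut V1 E1 D' (b + 1)" "r1 \<in> D'"
      "card D + card D' \<le> max (card V1 - b) 1" using glue.IH by blast
    obtain C C' where C: "vertex_cut V2 E2 C (b + 1)" "r2 \<notin> C" "vertex_cut V2 E2 C' (b + 1)" "r2 \<in> C'"
      "card C + card C' \<le> max (card V2 - b) 1" using glue.IH by blast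
    note gl = vertex_cut_glue[OF _ _ glue.hyps(3) ed root]
    have "r1 \<notin> D \<union> C'" using C(3) D(2) glue.hyps(3) root by (auto simp: vertex_cut_def)
    moreover have "vertex_cut (V1 \<union> V2) ?E (D \<union> C') (b + 1)" "vertex_cut (V1 \<union> V2) ?E (D' \<union> C) (b + 1)"
      using gl D C by auto
    \<comment> \<open>Since one part has more than \<open>b\<close> vertices, \<open>b\<close> is
      saved there; the other part contributes at most its number of vertices.\<close>
    moreover have "card (D \<union> C') + card (D' \<union> C) \<le> max (card (V1 \<union> V2) - b) 1"
      using card_Un_le[of D C'] card_Un_le[of D' C] D(5) C(5) cV True pos by linarith
    ultimately show ?thesis using D(4) by blast
  next
    case False
    \<comment> \<open>Both parts have at most \<open>b\<close> vertices, so \<open>{r1}\<close>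
      alone is a cut. The cut avoiding \<open>r1\<close> is empty if at most \<open>b + 1\<close>
      vertices are present, and otherwise comes from \<open>rtree_peel\<close> with
      \<open>s = b + 1\<close>.\<close>
    have "(r1, r1) \<notin> ?E" using rtree_irrefl[OF rtree.glue[OF glue.hyps]] .
    moreover have "card (V1 - {r1}) \<le> b + 1" "card (V2 - {}) \<le> b + 1"
      using False card_Diff1_le[of V1 r1] by auto
    ultimately have "vertex_cut V1 E1 {r1} (b + 1)" "vertex_cut V2 E2 {} (b + 1)"
      using fin root by (auto intro!: vertex_cut_const)
    from vertex_cut_glue[OF this glue.hyps(3) ed root] have r: "vertex_cut (V1 \<union> V2) ?E {r1} (b + 1)" by simp
    obtain D where "vertex_cut (V1 \<union> V2) ?E D (b + 1)" "r1 \<notin> D" "card D \<le> card (V1 \<union> V2) - (b + 1)"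
    proof (cases "card (V1 \<union> V2) \<le> b + 1")
      case True
      then have "vertex_cut (V1 \<union> V2) ?E {} (b + 1)"
        using fin root by (intro vertex_cut_const) auto
      then show ?thesis using that[of "{}"] by simp
    next
      case False
      then obtain D where "vertex_cut (V1 \<union> V2) ?E D (b + 1)" "r1 \<notin> D"
        "card D + (b + 1) \<le> card (V1 \<union> V2)"
        using rtree_peel[OF rtree.glue[OF glue.hyps], of "b + 1"] by auto
      then show ?thesis using that[of D] by simp
    qed
    then show ?thesis using r by - (rule exI[of _ D], rule exI[of _ "{r1}"], auto)
  qed
qed

text \<open>Descend from the root to a lowest vertex \<open>v\<close> whose subtree still has more
  than \<open>b\<close> vertices; all branches below it are small. Unless \<open>v\<close> is the
  root, the edge to its parent \<open>p\<close> splits the tree. Keeping \<open>r\<close> on the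
  side of \<open>p\<close> allows the induction to hang the rest of the tree there.\<close>

lemma rtree_hub:
  assumes "rtree V E r" "b + 1 \<le> card V"
  shows "vertex_cut V E {r} b \<or>
    (\<exists>V\<^sub>1 E\<^sub>1 p V\<^sub>2 E\<^sub>2 v. rtree V\<^sub>1 E\<^sub>1 p \<and> rtree V\<^sub>2 E\<^sub>2 v \<and> V\<^sub>1 \<inter> V\<^sub>2 = {} \<and> V = V\<^sub>1 \<union> V\<^sub>2 \<and>
       E = E\<^sub>1 \<union> E\<^sub>2 \<union> {(p, v), (v, p)} \<and> r \<in> V\<^sub>1 \<and> b + 1 \<le> card V\<^sub>2 \<and> vertex_cut V\<^sub>2 E\<^sub>2 {v} b)"
  using assms
proof (induction rule: rtree.induct)
  case (single r)
  have "vertex_cut {r} {} {r} b" by (auto intro!: vertex_cut_const)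
  then show ?case by blast
next
  case (glue Va Ea a Vb Eb c)
  let ?E = "Ea \<union> Eb \<union> {(a, c), (c, a)}"
  note fin = rtree_finite[OF glue.hyps(1)] rtree_finite[OF glue.hyps(2)]
  note root = rtree_root[OF glue.hyps(1)] rtree_root[OF glue.hyps(2)]
  note ed = rtree_edges[OF glue.hyps(1)] rtree_edges[OF glue.hyps(2)]
  show ?case
  proof (cases "b + 1 \<le> card Vb")
    case True
    from glue.IH(2)[OF this] show ?thesis
    proof (elim disjE exE conjE)
      assume "vertex_cut Vb Eb {c} b"
      then have "rtree Va Ea a \<and> rtree Vb Eb c \<and> Va \<inter> Vb = {} \<and> Va \<union> Vb = Va \<union> Vb \<and>
          ?E = Ea \<union> Eb \<union> {(a, c), (c, a)} \<and> a \<in> Va \<and> b + 1 \<le> card Vb \<and> vertex_cut Vb Eb {c} b"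
        using glue.hyps root True by blast
      then show ?thesis by (intro disjI2 exI)
    next
      fix V1 E1 p V2 E2 v
      assume *: "rtree V1 E1 p" "rtree V2 E2 v" "V1 \<inter> V2 = {}" "Vb = V1 \<union> V2"
        "Eb = E1 \<union> E2 \<union> {(p, v), (v, p)}" "c \<in> V1" "b + 1 \<le> card V2" "vertex_cut V2 E2 {v} b"
      have "rtree (V1 \<union> Va) (E1 \<union> Ea \<union> {(c, a), (a, c)}) p"
        using * glue.hyps by (intro rtree_attach) auto
      moreover have "Va \<union> Vb = (V1 \<union> Va) \<union> V2" "(V1 \<union> Va) \<inter> V2 = {}" "a \<in> V1 \<union> Va"
        "?E = (E1 \<union> Ea \<union> {(c, a), (a, c)}) \<union> E2 \<union> {(p, v), (v, p)}"
        using * glue.hyps root by auto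
      ultimately have "rtree (V1 \<union> Va) (E1 \<union> Ea \<union> {(c, a), (a, c)}) p \<and> rtree V2 E2 v \<and>
            (V1 \<union> Va) \<inter> V2 = {} \<and> Va \<union> Vb = (V1 \<union> Va) \<union> V2 \<and>
            ?E = (E1 \<union> Ea \<union> {(c, a), (a, c)}) \<union> E2 \<union> {(p, v), (v, p)} \<and> a \<in> V1 \<union> Va \<and>
            b + 1 \<le> card V2 \<and> vertex_cut V2 E2 {v} b"
          using *(2,7,8) by (intro conjI)
        then show ?thesis by (intro disjI2 exI)
    qed
  next
    case False
    then have e: "vertex_cut Vb Eb {} b" using fin root by (intro vertex_cut_const) auto
    show ?thesis
    proof (cases "b + 1 \<le> card Va")
      case True
      from glue.IH(1)[OF this] show ?thesis
      proof (elim disjE exE conjE)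
        assume "vertex_cut Va Ea {a} b"
        from vertex_cut_glue[OF this e glue.hyps(3) ed root] show ?thesis by simp
      next
        fix V1 E1 p V2 E2 v
        assume *: "rtree V1 E1 p" "rtree V2 E2 v" "V1 \<inter> V2 = {}" "Va = V1 \<union> V2"
          "Ea = E1 \<union> E2 \<union> {(p, v), (v, p)}" "a \<in> V1" "b + 1 \<le> card V2" "vertex_cut V2 E2 {v} b"
        have "rtree (V1 \<union> Vb) (E1 \<union> Eb \<union> {(a, c), (c, a)}) p"
          using * glue.hyps by (intro rtree_attach) auto
        moreover have "Va \<union> Vb = (V1 \<union> Vb) \<union> V2" "(V1 \<union> Vb) \<inter> V2 = {}" "a \<in> V1 \<union> Vb"
          "?E = (E1 \<union> Eb \<union> {(a, c), (c, a)}) \<union> E2 \<union> {(p, v), (v, p)}"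
          using * glue.hyps root by auto
        ultimately have "rtree (V1 \<union> Vb) (E1 \<union> Eb \<union> {(a, c), (c, a)}) p \<and> rtree V2 E2 v \<and>
            (V1 \<union> Vb) \<inter> V2 = {} \<and> Va \<union> Vb = (V1 \<union> Vb) \<union> V2 \<and>
            ?E = (E1 \<union> Eb \<union> {(a, c), (c, a)}) \<union> E2 \<union> {(p, v), (v, p)} \<and> a \<in> V1 \<union> Vb \<and>
            b + 1 \<le> card V2 \<and> vertex_cut V2 E2 {v} b"
          using *(2,7,8) by (intro conjI)
        then show ?thesis by (intro disjI2 exI)
      qed
    next
      case F: False
      have "vertex_cut Va Ea {a} b"
        using fin root F rtree_irrefl[OF glue.hyps(1)] card_Diff1_le[of Va a] by (intro vertex_cut_const) auto
      from vertex_cut_glue[OF this e glue.hyps(3) ed root] show ?thesis by simp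
    qed
  qed
qed

text \<open>For \<open>a + b = k\<close> and at most \<open>2 * k + 1\<close> vertices, the size
  bound says \<open>card D \<le> a\<close> by integrality. The cut is found at the vertex or edge
  given by \<open>rtree_hub\<close>.\<close>

lemma rtree_cut:
  assumes "rtree V E r" "2 * b + 2 \<le> card V"
  shows "\<exists>D. vertex_cut V E D (b + 1) \<and> 2 * card D + 2 * b \<le> card V"
proof -
  have "b + 1 \<le> card V" using assms(2) by simp
  from rtree_hub[OF assms(1) this] show ?thesis
  proof (elim disjE exE conjE)
    assume "vertex_cut V E {r} b"
    then have "vertex_cut V E {r} (b + 1)" by (rule vertex_cut_mono) simp
    then show ?thesis using assms(2) by (intro exI[of _ "{r}"]) auto
  next
    fix V1 E1 p V2 E2 v
    assume *: "rtree V1 E1 p" "rtree V2 E2 v" "V1 \<inter> V2 = {}" "V = V1 \<union> V2"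
      "E = E1 \<union> E2 \<union> {(p, v), (v, p)}" "b + 1 \<le> card V2" "vertex_cut V2 E2 {v} b"
    note fin = rtree_finite[OF *(1)] rtree_finite[OF *(2)]
    note root = rtree_root[OF *(1)] rtree_root[OF *(2)]
    note ed = rtree_edges[OF *(1)] rtree_edges[OF *(2)]
    note gl = vertex_cut_glue[OF _ _ *(3) ed root]
    have cV: "card V = card V1 + card V2" using fin *(3,4) by (simp add: card_Un_disjoint)
    show ?thesis
    proof (cases "b + 1 \<le> card V1")
      case True
      obtain D D' where D: "vertex_cut V1 E1 D (b + 1)" "p \<notin> D" "vertex_cut V1 E1 D' (b + 1)" "p \<in> D'"
        "card D + card D' \<le> max (card V1 - b) 1" using rtree_cut_pair[OF *(1)] by blast
      obtain C C' where C: "vertex_cut V2 E2 C (b + 1)" "v \<notin> C" "vertex_cut V2 E2 C' (b + 1)" "v \<in> C'"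
        "card C + card C' \<le> max (card V2 - b) 1" using rtree_cut_pair[OF *(2)] by blast
      have c: "vertex_cut V E (D \<union> C') (b + 1)" "vertex_cut V E (D' \<union> C) (b + 1)"
        using gl D C *(4,5) by auto
      \<comment> \<open>Both sides of the edge have more than \<open>b\<close> vertices, so
        \<open>b\<close> is saved twice. The smaller of the two crosswise cuts takes at most half of
        what remains.\<close>
      have "card (D \<union> C') + card (D' \<union> C) + 2 * b \<le> card V"
        using card_Un_le[of D C'] card_Un_le[of D' C] D(5) C(5) cV True *(6) by linarith
      then have "2 * card (D \<union> C') + 2 * b \<le> card V \<or> 2 * card (D' \<union> C) + 2 * b \<le> card V"
        by linarith
      then show ?thesis using c by blast
    next
      case False
      \<comment> \<open>The side of \<open>p\<close> is one more small branch at \<open>v\<close>,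
        so \<open>v\<close> alone suffices.\<close>
      then have "vertex_cut V1 E1 {} b" using fin root by (intro vertex_cut_const) auto
      from gl[OF this *(7)] have "vertex_cut V E {v} b" using *(4,5) by simp
      then have "vertex_cut V E {v} (b + 1)" by (rule vertex_cut_mono) simp
      then show ?thesis using assms(2) by (intro exI[of _ "{v}"]) auto
    qed
  qed
qed

text \<open>A longest path starts at a leaf, because a further neighbour of its first vertex would
  extend the path or close a cycle. The leaf is removed and later restored by
  \<open>rtree_attach\<close>.\<close>

lemma acyclic_connected_rtree:
  assumes "finite V" "V \<noteq> {}" "E \<subseteq> V \<times> V" "sym E" "irrefl E"
    and conn: "\<And>x y. x \<in> V \<Longrightarrow> y \<in> V \<Longrightarrow> (x, y) \<in> E\<^sup>*"
    and acyc: "\<And>xs. distinct xs \<Longrightarrow> length xs \<ge> 3 \<Longrightarrow> successively (\<lambda>x y. (x, y) \<in> E) xs \<Longrightarrow>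
       (last xs, hd xs) \<notin> E"
  shows "\<exists>r. rtree V E r"
  using assms
proof (induction "card V" arbitrary: V E rule: less_induct)
  case (less V E)
  show ?case
  proof (cases "\<exists>v. V = {v}")
    case True
    then obtain v where "V = {v}" by blast
    moreover then have "E = {}" using less.prems by (auto simp: irrefl_def)
    ultimately show ?thesis using rtree.single[of v] by auto
  next
    case False
    let ?P = "\<lambda>xs. xs \<noteq> [] \<and> distinct xs \<and> set xs \<subseteq> V \<and> successively (\<lambda>x y. (x, y) \<in> E) xs"
    obtain v where v: "v \<in> V" using less.prems by blast
    have "\<exists>xs. ?P xs \<and> (\<forall>ys. ?P ys \<longrightarrow> length ys \<le> length xs)"
    proof (rule ex_has_greatest_nat[of ?P "[v]" length "card V + 1"])
      show "?P [v]" using v by simp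
      show "\<forall>y. ?P y \<longrightarrow> length y < card V + 1"
        by (metis Suc_eq_plus1 card_mono distinct_card le_imp_less_Suc less.prems(1))
    qed
    then obtain xs where xs: "?P xs" and max: "\<And>ys. ?P ys \<Longrightarrow> length ys \<le> length xs" by blast
    obtain x ys where xys: "xs = x # ys" using xs by (cases xs) auto
    have x: "x \<in> V" using xs xys by simp
    have nb: "z \<in> set ys" if "(x, z) \<in> E" for z
    proof (rule ccontr)
      assume "z \<notin> set ys"
      moreover have "z \<noteq> x" using that less.prems(5) by (auto simp: irrefl_def)
      moreover have "(z, x) \<in> E" using that less.prems(4) by (auto dest: symD)
      ultimately have "?P (z # xs)" using xs xys that less.prems(3) by auto
      from max[OF this] show False by simp
    qed
    obtain w where "w \<in> V" "w \<noteq> x" using False x by blast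
    then obtain y0 where y0: "(x, y0) \<in> E"
      using less.prems(6)[OF x, of w] by (metis converse_rtranclE)
    then obtain y zs where ys: "ys = y # zs" using nb by (cases ys) auto
    have un: "z = y" if xz: "(x, z) \<in> E" for z
    proof (rule ccontr)
      assume "z \<noteq> y"
      then obtain us vs where "zs = us @ z # vs"
        using nb[OF xz] ys by (auto dest: split_list)
      then have d: "xs = (x # y # us @ [z]) @ vs" using xys ys by simp
      have "successively (\<lambda>x y. (x, y) \<in> E) ((x # y # us @ [z]) @ vs)" using d xs by blast
      then have "successively (\<lambda>x y. (x, y) \<in> E) (x # y # us @ [z])"
        by (simp only: successively_append_iff)
      moreover have "distinct (x # y # us @ [z])" using d xs by auto
      ultimately have "(last (x # y # us @ [z]), hd (x # y # us @ [z])) \<notin> E"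
        by (intro less.prems(7)) auto
      then show False using xz less.prems(4) by (auto dest: symD)
    qed
    have xy: "(x, y) \<in> E" using y0 un by blast
    have yV: "y \<in> V" "y \<noteq> x" using xy less.prems(3,5) by (auto simp: irrefl_def)
    let ?V = "V - {x}"
    let ?F = "E \<inter> ?V \<times> ?V"
    have E: "E = ?F \<union> {(y, x), (x, y)}"
    proof
      show "E \<subseteq> ?F \<union> {(y, x), (x, y)}"
        using un less.prems(3,4) by (auto dest: symD)
      show "?F \<union> {(y, x), (x, y)} \<subseteq> E" using xy less.prems(4) by (auto dest: symD)
    qed
    have "\<exists>r. rtree ?V ?F r"
    proof (rule less.hyps)
      show "card ?V < card V" using x less.prems(1) by (intro card_Diff1_less)
      show "finite ?V" "?V \<noteq> {}" using less.prems(1) yV by auto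
      show "?F \<subseteq> ?V \<times> ?V" by blast
      show "sym ?F" using less.prems(4) by (auto simp: sym_def)
      show "irrefl ?F" using less.prems(5) by (auto simp: irrefl_def)
      show "(last xs, hd xs) \<notin> ?F"
        if "distinct xs" "length xs \<ge> 3" "successively (\<lambda>x y. (x, y) \<in> ?F) xs" for xs
      proof -
        have "successively (\<lambda>x y. (x, y) \<in> E) xs"
          using that(3) by (rule successively_mono) auto
        then show ?thesis using less.prems(7)[OF that(1,2)] by auto
      qed
      \<comment> \<open>Folding the leaf \<open>x\<close> onto its neighbour \<open>y\<close> turns
        each path into one avoiding \<open>x\<close>; steps between \<open>x\<close> and
        \<open>y\<close> become stationary.\<close>
      let ?f = "\<lambda>z. if z = x then y else z"
      have f: "(?f u, ?f w) \<in> ?F\<^sup>*" if "(u, w) \<in> E\<^sup>*" for u w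
        using that
      proof induction
        case base
        then show ?case by simp
      next
        case (step w z)
        have "(w, z) \<in> ?F \<or> (w, z) = (y, x) \<or> (w, z) = (x, y)"
          using step(2) equalityD1[OF E] by blast
        then have "(?f w, ?f z) \<in> ?F\<^sup>*" using yV by auto
        then show ?case using step(3) by (meson rtrancl_trans)
      qed
      show "(u, w) \<in> ?F\<^sup>*" if "u \<in> ?V" "w \<in> ?V" for u w
        using f[OF less.prems(6)[of u w]] that by auto
    qed
    then obtain r where r: "rtree ?V ?F r" by blast
    have "rtree (?V \<union> {x}) (?F \<union> {} \<union> {(y, x), (x, y)}) r"
      using yV by (intro rtree_attach[OF r rtree.single]) auto
    moreover have "?V \<union> {x} = V" using x by blast
    moreover have "?F \<union> {} \<union> {(y, x), (x, y)} = E" using E[symmetric] by (simp only: Un_empty_right)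
    ultimately have "rtree V E r" by (simp only:)
    then show ?thesis by blast
  qed
qed

section \<open>Embedding a tree piece by piece\<close>

lemma connected_iff_rtrancl:
  assumes "pair_graph G"
  shows "Digraph_Component.connected (with_proj G) \<longleftrightarrow>
    pverts G \<noteq> {} \<and> (\<forall>u \<in> pverts G. \<forall>v \<in> pverts G. (u, v) \<in> (parcs G)\<^sup>*)"
proof -
  have sub: "parcs G \<subseteq> pverts G \<times> pverts G" and sym: "sym (parcs G)"
    using assms by (auto simp: pair_graph_iff)
  have "parcs (mk_symmetric (with_proj G)) = parcs G"
    using sym by (auto simp: mk_symmetric_def dest: symD)
  moreover have "(u, v) \<in> rtrancl_on (pverts G) (parcs G) \<longleftrightarrow> (u, v) \<in> (parcs G)\<^sup>*"
    if "u \<in> pverts G" for u v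
  proof
    assume "(u, v) \<in> (parcs G)\<^sup>*"
    then show "(u, v) \<in> rtrancl_on (pverts G) (parcs G)"
      by induction (use that sub in \<open>auto intro: rtrancl_on_into_rtrancl_on\<close>)
  qed (rule rtrancl_on_rtranclI)
  moreover have "pverts (mk_symmetric (with_proj G)) = pverts G" by (simp add: mk_symmetric_def)
  ultimately show ?thesis
    unfolding connected_def strongly_connected_def reachable_def by auto
qed

lemma pawalk_verts_zip: "pawalk_verts x (zip (x # xs) xs) = x # xs"
  by (induction xs arbitrary: x) auto

lemma pcas_zip: "pcas x (zip (x # xs) xs) (last (x # xs))"
  by (induction xs arbitrary: x) auto

lemma set_zip_successively:
  "successively (\<lambda>x y. (x, y) \<in> E) (x # xs) \<Longrightarrow> set (zip (x # xs) xs) \<subseteq> E"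
  by (induction xs arbitrary: x) auto

text \<open>Library cycles are lists of arcs: the vertex list is closed by repeating its head and
  then zipped with its own tail.\<close>

lemma cycle_of_vertex_list:
  assumes "pair_graph G" "distinct xs" "length xs \<ge> 3"
    and "successively (\<lambda>x y. (x, y) \<in> parcs G) xs" "(last xs, hd xs) \<in> parcs G"
  shows "\<exists>p. pre_digraph.cycle (with_proj G) p \<and> length p \<ge> 3"
proof -
  obtain x ys where xs: "xs = x # ys" using assms(3) by (cases xs) auto
  let ?p = "zip (x # ys @ [x]) (ys @ [x])"
  have "successively (\<lambda>x y. (x, y) \<in> parcs G) (xs @ [x])"
    unfolding successively_append_iff using assms(4,5) xs by simp
  then have "set ?p \<subseteq> parcs G"
    using set_zip_successively[of "parcs G" x "ys @ [x]"] xs by simp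
  moreover have "x \<in> pverts G"
    using assms(1,5) xs by (auto simp: pair_graph_iff)
  moreover have "pcas x ?p x" using pcas_zip[of x "ys @ [x]"] by simp
  ultimately have "pre_digraph.awalk (with_proj G) x ?p x"
    by (simp add: pre_digraph.awalk_def cas_with_proj_eq)
  moreover have "pawalk_verts x ?p = x # ys @ [x]" using pawalk_verts_zip[of x "ys @ [x]"] by simp
  moreover have "distinct (ys @ [x])" using assms(2) xs by auto
  ultimately have "pre_digraph.cycle (with_proj G) ?p"
    unfolding pre_digraph.cycle_def
    by (intro exI[of _ x] conjI) (auto simp: awalk_verts_with_proj_eq simp del: zip_Cons_Cons)
  moreover have "length ?p \<ge> 3" using assms(3) xs by simp
  ultimately show ?thesis by blast
qed

lemma undirected_tree_rtree:
  assumes "undirected_tree T"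
  shows "\<exists>r. rtree (pverts T) (parcs T) r"
proof -
  have T: "pair_graph T" and conn: "Digraph_Component.connected (with_proj T)"
    and acyc: "\<not> (\<exists>p. pre_digraph.cycle (with_proj T) p \<and> length p \<ge> 3)"
    using assms by (auto simp: undirected_tree_def)
  show ?thesis
    using T conn[unfolded connected_iff_rtrancl[OF T]] cycle_of_vertex_list[OF T] acyc
    by (intro acyclic_connected_rtree) (auto simp: pair_graph_iff)
qed

lemma undirected_subtree:
  assumes "undirected_tree T" "C \<subseteq> pverts T" "C \<noteq> {}"
    and "\<And>x y. x \<in> C \<Longrightarrow> y \<in> C \<Longrightarrow> (x, y) \<in> (parcs T \<inter> C \<times> C)\<^sup>*"
  defines "T' \<equiv> \<lparr>pverts = C, parcs = parcs T \<inter> C \<times> C\<rparr>"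
  shows "undirected_tree T'" "subgraph (with_proj T') (with_proj T)"
proof -
  have T: "pair_graph T" using assms(1) by (simp add: undirected_tree_def)
  interpret T: pair_graph T by fact
  have T': "pair_graph T'"
    using T assms(2) by (auto simp: pair_graph_iff T'_def sym_def irrefl_def intro: finite_subset)
  then have "wf_digraph (with_proj T')"
    by (auto simp: wf_digraph_wp_iff pair_wf_digraph_def pair_graph_iff)
  then show sub: "subgraph (with_proj T') (with_proj T)"
    using assms(2) T.wf_digraph by (auto simp: subgraph_def compatible_def T'_def)
  show "undirected_tree T'"
    unfolding undirected_tree_def
  proof (intro conjI)
    show "Digraph_Component.connected (with_proj T')"
      using assms(3,4) by (simp add: connected_iff_rtrancl[OF T']) (simp add: T'_def)
    show "\<not> (\<exists>p. pre_digraph.cycle (with_proj T') p \<and> length p \<ge> 3)"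
      using T.subgraph_cycle[OF sub] assms(1) by (auto simp: undirected_tree_def)
  qed fact
qed

section \<open>Embeddings from arc counts\<close>

lemma card_parcs:
  assumes "pair_graph G"
  shows "card (parcs G) = 2 * card (edges G)"
proof -
  have sym: "sym (parcs G)" and irr: "irrefl (parcs G)"
    and fin: "finite (parcs G)"
    using assms by (auto simp: pair_graph_iff intro: finite_subset)
  let ?F = "\<lambda>e. {p \<in> parcs G. {fst p, snd p} = e}"
  have E: "edges G = (\<lambda>p. {fst p, snd p}) ` parcs G" by (force simp: edges_def)
  have two: "card (?F e) = 2" if e: "e \<in> edges G" for e
  proof -
    obtain u v where uv: "(u, v) \<in> parcs G" "e = {u, v}" using e by (auto simp: edges_def)
    then have "u \<noteq> v" "(v, u) \<in> parcs G" using sym irr by (auto simp: irrefl_def dest: symD)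
    then have "?F e = {(u, v), (v, u)}" using uv by (auto simp: doubleton_eq_iff)
    then show ?thesis using \<open>u \<noteq> v\<close> by simp
  qed
  have "parcs G = (\<Union>e \<in> edges G. ?F e)" using E by auto
  then have "card (parcs G) = card (\<Union>e \<in> edges G. ?F e)" by simp
  also have "\<dots> = (\<Sum>e \<in> edges G. card (?F e))"
    using fin E by (intro card_UN_disjoint) auto
  also have "\<dots> = 2 * card (edges G)" using two by simp
  finally show ?thesis .
qed

text \<open>Only arcs of \<open>F\<close> inside \<open>V\<close> matter, so the same
  \<open>parcs T\<close> serves for all pieces of the tree.\<close>

definition embeds :: "'a set \<Rightarrow> ('a \<times> 'a) set \<Rightarrow> 'b set \<Rightarrow> ('b \<times> 'b) set \<Rightarrow> bool" where
  "embeds V F Q E \<longleftrightarrow>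
     (\<exists>h. inj_on h V \<and> h ` V \<subseteq> Q \<and> (\<forall>u \<in> V. \<forall>v \<in> V. (u, v) \<in> F \<longrightarrow> (h u, h v) \<in> E))"

lemma embedsI:
  assumes "inj_on h V" "h ` V \<subseteq> Q" "\<And>u v. u \<in> V \<Longrightarrow> v \<in> V \<Longrightarrow> (u, v) \<in> F \<Longrightarrow> (h u, h v) \<in> E"
  shows "embeds V F Q E"
  using assms unfolding embeds_def by blast

lemma embedsE:
  assumes "embeds V F Q E"
  obtains h where "inj_on h V" "h ` V \<subseteq> Q"
    "\<forall>u \<in> V. \<forall>v \<in> V. (u, v) \<in> F \<longrightarrow> (h u, h v) \<in> E"
  using assms unfolding embeds_def by blast

text \<open>Arcs count each edge twice, which absorbs the factor 1/2. The density is stated over the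
  integers since its factor is negative for a single vertex.\<close>

lemma erdos_sos_embeds:
  fixes Q :: "nat set"
  assumes "undirected_tree T"
    and es: "\<forall>T'. subgraph (with_proj T') (with_proj T) \<and> undirected_tree T' \<longrightarrow> erdos_sos_holds T'"
    and C: "C \<subseteq> pverts T" "C \<noteq> {}"
      "\<And>x y. x \<in> C \<Longrightarrow> y \<in> C \<Longrightarrow> (x, y) \<in> (parcs T \<inter> C \<times> C)\<^sup>*"
    and Q: "finite Q" "sym E" "irrefl E"
    and dense: "(int (card C) - 2) * int (card Q) < int (card (E \<inter> Q \<times> Q))"
  shows "embeds C (parcs T) Q E"
proof -
  define T' where "T' = \<lparr>pverts = C, parcs = parcs T \<inter> C \<times> C\<rparr>"
  define G where "G = \<lparr>pverts = Q, parcs = E \<inter> Q \<times> Q\<rparr>"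
  have tree: "undirected_tree T'" and "subgraph (with_proj T') (with_proj T)"
    unfolding T'_def using undirected_subtree[OF assms(1) C] by blast+
  then have "erdos_sos_holds T'" using es by blast
  moreover have G: "pair_graph G"
    using Q by (auto simp: pair_graph_iff G_def sym_def irrefl_def)
  moreover have "real (card (edges G)) > (real (card (pverts T')) - 2) / 2 * real (card Q)"
  proof -
    have "2 * card (edges G) = card (E \<inter> Q \<times> Q)" using card_parcs[OF G] by (simp add: G_def)
    then have "real_of_int ((int (card C) - 2) * int (card Q)) < real_of_int (2 * int (card (edges G)))"
      using dense by (metis of_int_less_iff of_nat_mult of_nat_numeral)
    then show ?thesis by (simp add: T'_def)
  qed
  ultimately have "contains_copy G T'"
    unfolding erdos_sos_holds_def by (auto simp: G_def)
  moreover have "pair_graph T'" using tree by (simp add: undirected_tree_def)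
  ultimately have "\<exists>h. inj_on h (pverts T') \<and> h ` pverts T' \<subseteq> pverts G \<and>
      (\<forall>(u, v) \<in> parcs T'. (h u, h v) \<in> parcs G)"
    using contains_copy_iff[OF G] by blast
  then obtain h where h: "inj_on h (pverts T')" "h ` pverts T' \<subseteq> pverts G"
    "\<forall>(u, v) \<in> parcs T'. (h u, h v) \<in> parcs G" by blast
  have "(h u, h v) \<in> E" if "u \<in> C" "v \<in> C" "(u, v) \<in> parcs T" for u v
    using h(3) that by (auto simp: T'_def G_def)
  moreover have "inj_on h C" "h ` C \<subseteq> Q" using h(1,2) by (simp_all add: T'_def G_def)
  ultimately show ?thesis by (intro embedsI[of h])
qed

lemma forest_embeds:
  fixes Q :: "nat set"
  assumes T: "undirected_tree T"
    and es: "\<forall>T'. subgraph (with_proj T') (with_proj T) \<and> undirected_tree T' \<longrightarrow> erdos_sos_holds T'"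
    and Q: "finite Q" "sym E" "irrefl E"
    and dense: "\<And>U. U \<subseteq> Q \<Longrightarrow> card U \<le> L \<Longrightarrow>
      (int b - 1) * int (card (Q - U)) < int (card (E \<inter> (Q - U) \<times> (Q - U)))"
    and W: "W \<subseteq> pverts T" "\<And>x y. x \<in> W \<Longrightarrow> y \<in> W \<Longrightarrow> (x, y) \<in> parcs T \<Longrightarrow> g x = g y"
      "\<And>c. card {x \<in> W. g x = c} \<le> b + 1"
    and U: "U \<subseteq> Q" "card U + card W \<le> L"
  shows "embeds W (parcs T) (Q - U) E"
  using W U
proof (induction "card W" arbitrary: W U rule: less_induct)
  case (less W U)
  have gT: "pair_graph T" using T by (simp add: undirected_tree_def)
  have finW: "finite W" using less.prems(1) gT by (auto simp: pair_graph_iff intro: finite_subset)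
  have symT: "sym (parcs T)" using gT by (simp add: pair_graph_iff)
  show ?case
  proof (cases "W = {}")
    case True
    then show ?thesis by (simp add: embeds_def)
  next
    case False
    then obtain w where w: "w \<in> W" by blast
    define C where "C = {y. (w, y) \<in> (parcs T \<inter> W \<times> W)\<^sup>*}"
    have CW: "C \<subseteq> W"
    proof
      fix y assume "y \<in> C"
      then have "(w, y) \<in> (parcs T \<inter> W \<times> W)\<^sup>*" by (simp add: C_def)
      then show "y \<in> W" by induction (use w in auto)
    qed
    have wC: "w \<in> C" by (simp add: C_def)
    have closed: "v \<in> C" if "u \<in> C" "v \<in> W" "(u, v) \<in> parcs T" for u v
    proof -
      have "(u, v) \<in> parcs T \<inter> W \<times> W" using that CW by auto
      then show ?thesis using that(1) unfolding C_def by (simp add: rtrancl.rtrancl_into_rtrancl)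
    qed
    have gC: "g y = g w" if "y \<in> C" for y
    proof -
      have "(w, y) \<in> (parcs T \<inter> W \<times> W)\<^sup>*" using that by (simp add: C_def)
      then show ?thesis by induction (use less.prems(2) in auto)
    qed
    have "card C \<le> card {x \<in> W. g x = g w}"
      using finW CW gC by (intro card_mono) auto
    then have cC: "card C \<le> b + 1" using less.prems(3)[of "g w"] by linarith
    have wy: "(w, y) \<in> (parcs T \<inter> C \<times> C)\<^sup>*" if "y \<in> C" for y
    proof -
      have "(w, y) \<in> (parcs T \<inter> W \<times> W)\<^sup>*" using that by (simp add: C_def)
      then show ?thesis
      proof induction
        case (step y z)
        have "y \<in> C" "z \<in> C" using step(1,2) unfolding C_def by (auto intro: rtrancl.rtrancl_into_rtrancl)
        then have "(y, z) \<in> parcs T \<inter> C \<times> C" using step(2) by blast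
        with step(3) show ?case by (rule rtrancl.rtrancl_into_rtrancl)
      qed simp
    qed
    have "sym (parcs T \<inter> C \<times> C)" using symT by (auto simp: sym_def)
    then have "sym ((parcs T \<inter> C \<times> C)\<^sup>*)" by (rule sym_rtrancl)
    then have conn: "(x, y) \<in> (parcs T \<inter> C \<times> C)\<^sup>*" if "x \<in> C" "y \<in> C" for x y
      using wy that by (meson rtrancl_trans symD)
    have finU: "finite U" using less.prems(4) Q(1) by (rule finite_subset)
    have d: "(int (card C) - 2) * int (card (Q - U)) < int (card (E \<inter> (Q - U) \<times> (Q - U)))"
    proof -
      have "(int (card C) - 2) * int (card (Q - U)) \<le> (int b - 1) * int (card (Q - U))"
        using cC by (intro mult_right_mono) auto
      also have "\<dots> < int (card (E \<inter> (Q - U) \<times> (Q - U)))"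
        using less.prems(4,5) by (intro dense) auto
      finally show ?thesis .
    qed
    have Cp: "C \<subseteq> pverts T" "C \<noteq> {}" using CW less.prems(1) wC by auto
    have "embeds C (parcs T) (Q - U) E"
      using erdos_sos_embeds[OF T es Cp conn _ Q(2,3) d] Q(1) by blast
    then obtain h where h: "inj_on h C" "h ` C \<subseteq> Q - U"
      "\<forall>u \<in> C. \<forall>v \<in> C. (u, v) \<in> parcs T \<longrightarrow> (h u, h v) \<in> E"
      by (rule embedsE)
    have fC: "finite C" using CW finW by (rule finite_subset)
    have "card (U \<union> h ` C) \<le> card U + card C"
      using card_Un_le[of U "h ` C"] card_image_le[OF fC, of h] by linarith
    moreover have "card W = card C + card (W - C)"
      using CW finW fC by (simp add: card_Diff_subset card_mono)
    ultimately have u: "card (U \<union> h ` C) + card (W - C) \<le> L" using less.prems(5) by linarith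
    have "embeds (W - C) (parcs T) (Q - (U \<union> h ` C)) E"
    proof (rule less.hyps)
      show "card (W - C) < card W" using wC CW finW by (intro psubset_card_mono) auto
      show "U \<union> h ` C \<subseteq> Q" using h(2) less.prems(4) by blast
      show "card {x \<in> W - C. g x = c} \<le> b + 1" for c
        using card_mono[of "{x \<in> W. g x = c}" "{x \<in> W - C. g x = c}"] finW less.prems(3)[of c]
        by (auto intro: order_trans)
    qed (use less.prems u in auto)
    then obtain h' where h': "inj_on h' (W - C)" "h' ` (W - C) \<subseteq> Q - (U \<union> h ` C)"
      "\<forall>u \<in> W - C. \<forall>v \<in> W - C. (u, v) \<in> parcs T \<longrightarrow> (h' u, h' v) \<in> E"
      by (rule embedsE)
    let ?h = "\<lambda>x. if x \<in> C then h x else h' x"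
    have "inj_on ?h W"
    proof (rule inj_onI)
      fix x y assume xy: "x \<in> W" "y \<in> W" "?h x = ?h y"
      have ne: "h u \<noteq> h' v" if "u \<in> C" "v \<in> W - C" for u v
      proof -
        have "h' v \<in> Q - (U \<union> h ` C)" using h'(2) that(2) by blast
        moreover have "h u \<in> h ` C" using that(1) by (rule imageI)
        ultimately show ?thesis by (metis DiffD2 UnI2)
      qed
      show "x = y"
        using xy ne[of x y] ne[of y x] inj_onD[OF h(1), of x y] inj_onD[OF h'(1), of x y]
        by (auto split: if_splits)
    qed
    moreover have "?h ` W \<subseteq> Q - U" using h(2) h'(2) by auto
    moreover have "(?h u, ?h v) \<in> E" if "u \<in> W" "v \<in> W" "(u, v) \<in> parcs T" for u v
    proof -
      \<comment> \<open>\<open>C\<close> is a whole component of \<open>W\<close>, so no tree arc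
        joins it to the rest of \<open>W\<close>.\<close>
      have "u \<in> C \<longleftrightarrow> v \<in> C" using closed that symT by (meson symD)
      then show ?thesis using h(3) h'(3) that by auto
    qed
    ultimately show ?thesis by (intro embedsI[of ?h])
  qed
qed

text \<open>The cut \<open>D\<close> goes into \<open>P\<close> in any injective way, being
  independent and completely joined to \<open>Q\<close>; the remaining forest goes into
  \<open>Q\<close> by \<open>forest_embeds\<close>.\<close>

lemma tree_embeds:
  fixes P Q :: "nat set" and T :: "'a pair_pre_digraph"
  assumes T: "undirected_tree T"
    and es: "\<forall>T'. subgraph (with_proj T') (with_proj T) \<and> undirected_tree T' \<longrightarrow> erdos_sos_holds T'"
    and size: "2 * b + 2 \<le> card (pverts T)" "card (pverts T) \<le> 2 * a + 2 * b + 1"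
    and Q: "finite P" "finite Q" "sym E" "irrefl E" "P \<inter> Q = {}" "a \<le> card P" "P \<times> Q \<subseteq> E"
    and dense: "\<And>U. U \<subseteq> Q \<Longrightarrow> card U \<le> card (pverts T) \<Longrightarrow>
      (int b - 1) * int (card (Q - U)) < int (card (E \<inter> (Q - U) \<times> (Q - U)))"
  shows "embeds (pverts T) (parcs T) (P \<union> Q) E"
proof -
  have gT: "finite (pverts T)" "parcs T \<subseteq> pverts T \<times> pverts T"
    using T by (auto simp: undirected_tree_def pair_graph_iff)
  obtain r where "rtree (pverts T) (parcs T) r" using undirected_tree_rtree[OF T] by blast
  then obtain D where D: "vertex_cut (pverts T) (parcs T) D (b + 1)" "2 * card D + 2 * b \<le> card (pverts T)"
    using rtree_cut[OF _ size(1)] by blast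
  obtain g :: "'a \<Rightarrow> 'a" where g: "\<And>x y. (x, y) \<in> parcs T \<Longrightarrow> x \<in> D \<or> y \<in> D \<or> g x = g y"
    "\<And>c. card {x \<in> pverts T - D. g x = c} \<le> b + 1" and DT: "D \<subseteq> pverts T" "parcs T \<inter> D \<times> D = {}"
    using D(1) unfolding vertex_cut_def by blast
  have finD: "finite D" using DT(1) gT(1) by (rule finite_subset)
  have "embeds (pverts T - D) (parcs T) (Q - {}) E"
  proof (rule forest_embeds[OF T es Q(2-4) dense, where g = g])
    show "card {} + card (pverts T - D) \<le> card (pverts T)" using gT by (simp add: card_mono)
  qed (use g in auto)
  then obtain h where h: "inj_on h (pverts T - D)" "h ` (pverts T - D) \<subseteq> Q"
    "\<forall>u \<in> pverts T - D. \<forall>v \<in> pverts T - D. (u, v) \<in> parcs T \<longrightarrow> (h u, h v) \<in> E"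
    unfolding Diff_empty by (rule embedsE)
  have "card D \<le> card P" using D(2) size(2) Q(6) by linarith
  then obtain d where d: "d ` D \<subseteq> P" "inj_on d D" using card_le_inj[OF finD Q(1)] by blast
  let ?h = "\<lambda>x. if x \<in> D then d x else h x"
  have "inj_on ?h (pverts T)"
  proof (rule inj_onI)
    fix x y assume xy: "x \<in> pverts T" "y \<in> pverts T" "?h x = ?h y"
    have ne: "d u \<noteq> h v" if "u \<in> D" "v \<in> pverts T - D" for u v
      using that d(1) h(2) Q(5) by blast
    show "x = y"
      using xy ne[of x y] ne[of y x] inj_onD[OF d(2), of x y] inj_onD[OF h(1), of x y]
      by (auto split: if_splits)
  qed
  moreover have "?h ` pverts T \<subseteq> P \<union> Q" using d(1) h(2) by auto
  moreover have "(?h u, ?h v) \<in> E" if uv: "u \<in> pverts T" "v \<in> pverts T" "(u, v) \<in> parcs T" for u v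
  proof -
    consider "u \<in> D" "v \<notin> D" | "u \<notin> D" "v \<in> D" | "u \<notin> D" "v \<notin> D" using DT(2) uv(3) by blast
    then show ?thesis
    proof cases
      case 1
      then have "d u \<in> P" "h v \<in> Q" using d(1) h(2) uv(2) by auto
      then show ?thesis using 1 Q(7) by auto
    next
      case 2
      then have "d v \<in> P" "h u \<in> Q" using d(1) h(2) uv(1) by auto
      then show ?thesis using 2 Q(7) symD[OF Q(3)] by auto
    qed (use h(3) uv in auto)
  qed
  ultimately show ?thesis by (intro embedsI[of ?h])
qed

section \<open>Graphs whose neighbourhoods are sparse\<close>

definition arcs_between :: "('a \<times> 'a) set \<Rightarrow> 'a set \<Rightarrow> 'a set \<Rightarrow> nat" where
  "arcs_between E X Y = card (E \<inter> X \<times> Y)"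

lemma arcs_between_sum:
  assumes "finite X" "finite Y"
  shows "arcs_between E X Y = (\<Sum>x\<in>X. card (E `` {x} \<inter> Y))"
proof -
  have "E \<inter> X \<times> Y = Sigma X (\<lambda>x. E `` {x} \<inter> Y)" by auto
  then show ?thesis using assms by (simp add: arcs_between_def)
qed

lemma arcs_between_sym:
  assumes "sym E"
  shows "arcs_between E X Y = arcs_between E Y X"
proof -
  have "bij_betw prod.swap (E \<inter> X \<times> Y) (E \<inter> Y \<times> X)"
    using assms by (intro bij_betw_byWitness[where f' = prod.swap]) (auto dest: symD)
  then show ?thesis unfolding arcs_between_def by (rule bij_betw_same_card)
qed

lemma arcs_between_Un_right:
  assumes "finite X" "finite Y" "finite Z" "Y \<inter> Z = {}"
  shows "arcs_between E X (Y \<union> Z) = arcs_between E X Y + arcs_between E X Z"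
proof -
  have "E \<inter> X \<times> (Y \<union> Z) = (E \<inter> X \<times> Y) \<union> (E \<inter> X \<times> Z)" by auto
  then show ?thesis
    unfolding arcs_between_def using assms by (simp only:) (intro card_Un_disjoint, auto)
qed

lemma arcs_between_le:
  assumes "finite X" "finite Y"
  shows "arcs_between E X Y \<le> card X * card Y"
proof -
  have "card (E \<inter> X \<times> Y) \<le> card (X \<times> Y)" using assms by (intro card_mono) auto
  then show ?thesis by (simp add: arcs_between_def card_cartesian_product)
qed

lemma arcs_between_le_degree:
  assumes "finite X" "finite Y" "\<And>x. x \<in> X \<Longrightarrow> card (E `` {x} \<inter> Y) \<le> d"
  shows "arcs_between E X Y \<le> d * card X"
  using sum_bounded_above[of X "\<lambda>x. card (E `` {x} \<inter> Y)" d] assms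
  by (simp add: arcs_between_sum mult.commute)

lemma arcs_between_Un:
  assumes "finite X" "finite Y" "X \<inter> Y = {}" "sym E"
  shows "arcs_between E (X \<union> Y) (X \<union> Y) =
    arcs_between E X X + 2 * arcs_between E X Y + arcs_between E Y Y"
proof -
  have "arcs_between E (X \<union> Y) (X \<union> Y) = arcs_between E (X \<union> Y) X + arcs_between E (X \<union> Y) Y"
    using assms by (intro arcs_between_Un_right) auto
  also have "arcs_between E (X \<union> Y) X = arcs_between E X X + arcs_between E X Y"
    using assms by (subst arcs_between_sym) (auto simp: arcs_between_Un_right)
  also have "arcs_between E (X \<union> Y) Y = arcs_between E Y X + arcs_between E Y Y"
    using assms by (subst arcs_between_sym) (auto simp: arcs_between_Un_right)
  also have "arcs_between E Y X = arcs_between E X Y" using assms(4) by (rule arcs_between_sym)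
  finally show ?thesis by simp
qed

lemma arcs_between_insert:
  assumes "finite X" "x \<notin> X" "sym E" "irrefl E"
  shows "arcs_between E (insert x X) (insert x X) = arcs_between E X X + 2 * card (E `` {x} \<inter> X)"
proof -
  have "arcs_between E ({x} \<union> X) ({x} \<union> X) =
      arcs_between E {x} {x} + 2 * arcs_between E {x} X + arcs_between E X X"
    using assms by (intro arcs_between_Un) auto
  moreover have "arcs_between E {x} {x} = 0"
    using assms(4) by (auto simp: arcs_between_def irrefl_def)
  moreover have "arcs_between E {x} X = card (E `` {x} \<inter> X)"
    using assms(1) by (simp add: arcs_between_sum)
  ultimately show ?thesis by simp
qed

lemma arcs_between_remove:
  assumes "finite X" "S \<subseteq> X" "sym E"
  shows "arcs_between E X X \<le> arcs_between E S S + 2 * arcs_between E (X - S) X"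
proof -
  have fin: "finite S" "finite (X - S)" using assms by (auto intro: finite_subset)
  have X: "S \<union> (X - S) = X" using assms by blast
  have "arcs_between E X X =
      arcs_between E S S + 2 * arcs_between E S (X - S) + arcs_between E (X - S) (X - S)"
    using arcs_between_Un[of S "X - S" E] fin assms(3) X by simp
  moreover have "arcs_between E (X - S) X = arcs_between E (X - S) S + arcs_between E (X - S) (X - S)"
    using arcs_between_Un_right[of "X - S" S "X - S" E] fin X by simp
  moreover have "arcs_between E S (X - S) = arcs_between E (X - S) S"
    using assms(3) by (rule arcs_between_sym)
  ultimately show ?thesis by simp
qed

section \<open>Growth of the extremal function\<close>

lemma f_bound_set_finite:
  "finite {n\<^sub>0 * n\<^sub>1 + ((k - 1) * n\<^sub>0) div 2 | n\<^sub>0 n\<^sub>1. n\<^sub>0 + n\<^sub>1 = (n :: nat)}"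
proof -
  have "{n\<^sub>0 * n\<^sub>1 + ((k - 1) * n\<^sub>0) div 2 | n\<^sub>0 n\<^sub>1. n\<^sub>0 + n\<^sub>1 = n} \<subseteq>
      (\<lambda>(x, y). x * y + ((k - 1) * x) div 2) ` ({..n} \<times> {..n})" by force
  then show ?thesis by (rule finite_subset) simp
qed

lemma f_bound_ge: "n\<^sub>0 + n\<^sub>1 = n \<Longrightarrow> n\<^sub>0 * n\<^sub>1 + ((k - 1) * n\<^sub>0) div 2 \<le> f_bound n k"
  unfolding f_bound_def by (rule Max_ge[OF f_bound_set_finite]) blast

lemma f_bound_attained: "\<exists>n\<^sub>0 n\<^sub>1. n\<^sub>0 + n\<^sub>1 = n \<and> f_bound n k = n\<^sub>0 * n\<^sub>1 + ((k - 1) * n\<^sub>0) div 2"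
proof -
  have "0 + n = n" by simp
  then have "{n\<^sub>0 * n\<^sub>1 + ((k - 1) * n\<^sub>0) div 2 | n\<^sub>0 n\<^sub>1. n\<^sub>0 + n\<^sub>1 = n} \<noteq> {}" by blast
  from Max_in[OF f_bound_set_finite this] show ?thesis unfolding f_bound_def by auto
qed

text \<open>A vertex added to the smaller class gains the size of the larger one, at least
  \<open>m / 2\<close>, and the rounded term does not drop.\<close>

lemma f_bound_Suc: "2 * f_bound m k + m \<le> 2 * f_bound (Suc m) k"
proof -
  obtain p q where pq: "p + q = m" "f_bound m k = p * q + ((k - 1) * p) div 2"
    using f_bound_attained by blast
  show ?thesis
  proof (cases "q \<le> p")
    case True
    have "p * (q + 1) + ((k - 1) * p) div 2 \<le> f_bound (Suc m) k"
      using pq(1) by (intro f_bound_ge) simp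
    then show ?thesis using True pq by simp
  next
    case False
    have "(p + 1) * q + ((k - 1) * (p + 1)) div 2 \<le> f_bound (Suc m) k"
      using pq(1) by (intro f_bound_ge) simp
    moreover have "((k - 1) * p) div 2 \<le> ((k - 1) * (p + 1)) div 2"
      by (intro div_le_mono mult_le_mono2) simp
    ultimately show ?thesis using False pq by simp
  qed
qed

lemma f_bound_add: "2 * f_bound m k + z * m \<le> 2 * f_bound (m + z) k"
proof (induction z)
  case (Suc z)
  have "2 * f_bound (m + z) k + (m + z) \<le> 2 * f_bound (m + Suc z) k"
    using f_bound_Suc[of "m + z" k] by simp
  then show ?case using Suc by simp
qed simp

text \<open>The balanced split already gives this. It settles graphs with fewer than
  \<open>n^2 / 4\<close> edges.\<close>

lemma f_bound_square: "n\<^sup>2 \<le> 4 * f_bound n k + 1"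
proof -
  have "(n div 2) * (n - n div 2) \<le> f_bound n k"
    using f_bound_ge[of "n div 2" "n - n div 2" n k] by simp
  moreover have "n\<^sup>2 \<le> 4 * ((n div 2) * (n - n div 2)) + 1"
  proof (cases "even n")
    case True
    then obtain m where "n = 2 * m" by blast
    then show ?thesis by (simp add: power2_eq_square)
  next
    case False
    then obtain m where "n = 2 * m + 1" using oddE by blast
    then show ?thesis by (simp add: power2_eq_square algebra_simps)
  qed
  ultimately show ?thesis by linarith
qed

lemma card_Diff_plus:
  assumes "finite Y" "R \<subseteq> Y"
  shows "card Y = card (Y - R) + card R"
proof -
  have "finite R" using assms by (auto intro: finite_subset)
  then show ?thesis using assms card_mono[OF assms] by (simp add: card_Diff_subset)
qed

lemma finite_ex_max:
  fixes f :: "'a \<Rightarrow> nat"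
  assumes "finite X" "X \<noteq> {}"
  shows "\<exists>x \<in> X. \<forall>y \<in> X. f y \<le> f x"
proof -
  have "Max (f ` X) \<in> f ` X" using assms by (intro Max_in) auto
  then obtain x where "x \<in> X" "f x = Max (f ` X)" by auto
  then show ?thesis using assms(1) by (intro bexI[of _ x]) auto
qed

lemma power5_eq: "(x :: 'a :: monoid_mult) ^ 5 = x * x * x * x * x"
  by (simp add: eval_nat_numeral mult.assoc)

lemmas small_powers = power2_eq_square power3_eq_cube power4_eq_xxxx power5_eq

text \<open>
  The two consequences of \<open>suspension T\<close>-freeness on which the upper bound rests:
  \<open>sparse_nbhd\<close> is the Erdos-Sos bound for \<open>T\<close> in a neighbourhood, and \<open>sparse_part\<close> is the
  contrapositive of \<open>tree_embeds\<close>. As arcs are ordered pairs, they count every edge twice.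
\<close>

locale hat_free =
  fixes V :: "'a set" and E :: "('a \<times> 'a) set" and k n :: nat
  assumes finV: "finite V" and cardV: "card V = n"
    and EV: "E \<subseteq> V \<times> V" and symE: "sym E" and irreflE: "irrefl E"
    and k1: "1 \<le> k" and nk: "4 * (4 * k) ^ 6 \<le> n"
    and sparse_nbhd: "v \<in> V \<Longrightarrow> arcs_between E (E `` {v}) (E `` {v}) \<le> (2 * k - 1) * card (E `` {v})"
    and sparse_part: "v \<in> V \<Longrightarrow> P \<subseteq> E `` {v} \<Longrightarrow> Q \<subseteq> E `` {v} \<Longrightarrow> P \<inter> Q = {} \<Longrightarrow> P \<times> Q \<subseteq> E \<Longrightarrow>
      1 \<le> a \<Longrightarrow> a + b = k \<Longrightarrow> a \<le> card P \<Longrightarrow>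
      \<exists>U \<subseteq> Q. card U \<le> 2 * k + 1 \<and>
        int (arcs_between E (Q - U) (Q - U)) \<le> (int b - 1) * int (card (Q - U))"
begin

abbreviation N :: "'a \<Rightarrow> 'a set" where "N x \<equiv> E `` {x}"
abbreviation ar :: "'a set \<Rightarrow> 'a set \<Rightarrow> nat" where "ar \<equiv> arcs_between E"

lemma n_large: "16384 * k ^ 6 \<le> n"
  using nk by (simp add: power_mult_distrib)

lemma n_large': "j \<le> 6 \<Longrightarrow> 16384 * k ^ j \<le> n"
  using n_large power_increasing[of j 6 k] k1 by (meson le_trans mult_le_mono2)

lemma N_sub: "N x \<subseteq> V"
  using EV by auto

lemma fin_N: "finite (N x)"
  using finite_subset[OF N_sub finV] .

lemma card_E: "card E = ar V V"
  using EV by (simp add: arcs_between_def Int_absorb2)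

lemma complete_pair_small:
  assumes "v \<in> V" "P \<subseteq> N v" "Q \<subseteq> N v" "P \<inter> Q = {}" "P \<times> Q \<subseteq> E" "k \<le> card P"
  shows "card Q \<le> 2 * k + 1"
proof (rule ccontr)
  assume *: "\<not> card Q \<le> 2 * k + 1"
  \<comment> \<open>For \<open>a = k\<close> and \<open>b = 0\<close> the right-hand side is
    \<open>- card (Q - U)\<close>, which forces \<open>Q = U\<close>.\<close>
  obtain U where U: "U \<subseteq> Q" "card U \<le> 2 * k + 1"
    "int (ar (Q - U) (Q - U)) \<le> (int 0 - 1) * int (card (Q - U))"
    using sparse_part[OF assms(1-5) k1 _ assms(6)] by auto
  have "finite Q" using assms(3) fin_N by (rule finite_subset)
  moreover have "card (Q - U) = 0" using U(3) by simp
  ultimately have "Q \<subseteq> U" by auto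
  then have "Q = U" using U(1) by blast
  then show False using * U(2) by simp
qed

text \<open>A union bound over \<open>P\<close>; the factor \<open>c\<close> avoids
  division.\<close>

lemma common_neighbours:
  assumes "finite P" "finite Y" "\<And>p. p \<in> P \<Longrightarrow> c * card (Y - N p) \<le> n"
  shows "c * card {y \<in> Y. \<exists>p \<in> P. y \<notin> N p} \<le> card P * n"
proof -
  have "{y \<in> Y. \<exists>p \<in> P. y \<notin> N p} = (\<Union>p \<in> P. Y - N p)" by auto
  then have "card {y \<in> Y. \<exists>p \<in> P. y \<notin> N p} \<le> (\<Sum>p \<in> P. card (Y - N p))"
    using card_UN_le[OF assms(1), of "\<lambda>p. Y - N p"] by simp
  then have "c * card {y \<in> Y. \<exists>p \<in> P. y \<notin> N p} \<le> c * (\<Sum>p \<in> P. card (Y - N p))"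
    by (rule mult_le_mono2)
  also have "\<dots> = (\<Sum>p \<in> P. c * card (Y - N p))" by (simp add: sum_distrib_left)
  also have "\<dots> \<le> card P * n"
    using sum_bounded_above[of P "\<lambda>p. c * card (Y - N p)" n] assms(3) by simp
  finally show ?thesis .
qed

text \<open>Take \<open>A\<close> as the neighbourhood of a vertex of maximum degree. Summing
  degrees over the rest \<open>B\<close> gives \<open>ar A B + ar B B \<le> card A * card B\<close>,
  hence at most \<open>n^2 / 4\<close>. As \<open>card E\<close> is at least \<open>n^2 / 2\<close>,
  this forces \<open>ar B B \<le> ar A A\<close>, and \<open>sparse_nbhd\<close> bounds the
  latter.\<close>

lemma good_partition:
  assumes "n\<^sup>2 \<le> 2 * card E"
  shows "\<exists>A \<subseteq> V. ar A A + ar (V - A) (V - A) \<le> 4 * k * n"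
proof -
  have "n > 0" using n_large'[of 0] by simp
  then have "V \<noteq> {}" using cardV by auto
  then obtain v where v: "v \<in> V" "\<And>x. x \<in> V \<Longrightarrow> card (N x) \<le> card (N v)"
    using finite_ex_max[OF finV, of "\<lambda>x. card (N x)"] by blast
  let ?A = "N v" and ?B = "V - N v"
  have fin: "finite ?A" "finite ?B" using fin_N finV by auto
  have AB: "?A \<union> ?B = V" "?A \<inter> ?B = {}" using N_sub by auto
  have "card V = card ?A + card ?B" using card_Un_disjoint[OF fin AB(2)] AB(1) by simp
  then have n: "n = card ?A + card ?B" using cardV by simp
  have e: "card E = ar ?A ?A + 2 * ar ?A ?B + ar ?B ?B"
    using arcs_between_Un[OF fin AB(2) symE] AB(1) card_E by simp
  have "ar ?B V \<le> card ?A * card ?B"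
    using v(2) N_sub by (intro arcs_between_le_degree fin finV) (auto simp: Int_absorb2)
  moreover have "ar ?B V = ar ?B ?A + ar ?B ?B"
    using arcs_between_Un_right[OF fin(2) fin AB(2)] AB(1) by simp
  ultimately have "ar ?A ?B + ar ?B ?B \<le> card ?A * card ?B"
    using arcs_between_sym[OF symE, of ?A ?B] by simp
  moreover have "4 * (card ?A * card ?B) \<le> n\<^sup>2"
  proof -
    have "0 \<le> (int (card ?A) - int (card ?B))\<^sup>2" by simp
    then have "int (4 * (card ?A * card ?B)) \<le> int (n\<^sup>2)"
      using n by (simp add: power2_eq_square algebra_simps)
    then show ?thesis by (simp only: of_nat_le_iff)
  qed
  ultimately have "ar ?B ?B \<le> ar ?A ?A" using e assms by linarith
  moreover have "ar ?A ?A \<le> 2 * k * n"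
  proof -
    have "ar ?A ?A \<le> (2 * k - 1) * card ?A" using sparse_nbhd[OF v(1)] .
    also have "\<dots> \<le> 2 * k * n" using n by (intro mult_le_mono) auto
    finally show ?thesis .
  qed
  ultimately have "ar ?A ?A + ar ?B ?B \<le> 4 * k * n" by linarith
  then show ?thesis using N_sub by blast
qed

text \<open>Choose the partition with fewest inner arcs. Moving one vertex across cannot lower this
  number, which is the comparison of its degrees to both sides.\<close>

lemma max_cut:
  assumes "n\<^sup>2 \<le> 2 * card E"
  shows "\<exists>A \<subseteq> V. ar A A + ar (V - A) (V - A) \<le> 4 * k * n \<and>
    (\<forall>x \<in> A. card (N x \<inter> A) \<le> card (N x \<inter> (V - A))) \<and>
    (\<forall>x \<in> V - A. card (N x \<inter> (V - A)) \<le> card (N x \<inter> A))"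
proof -
  let ?w = "\<lambda>A. ar A A + ar (V - A) (V - A)"
  obtain A0 where A0: "A0 \<subseteq> V" "?w A0 \<le> 4 * k * n" using good_partition[OF assms] by blast
  obtain A where A: "A \<subseteq> V" "\<And>A'. A' \<subseteq> V \<Longrightarrow> ?w A \<le> ?w A'"
    using ex_has_least_nat[of "\<lambda>A. A \<subseteq> V" A0 ?w] A0(1) by blast
  have fin: "finite A" "finite (V - A)" using A(1) finV by (auto intro: finite_subset)
  have "card (N x \<inter> A) \<le> card (N x \<inter> (V - A))" if x: "x \<in> A" for x
  proof -
    have "?w A \<le> ?w (A - {x})" using A(1) by (intro A(2)) auto
    moreover have "V - (A - {x}) = insert x (V - A)" using x A(1) by auto
    moreover have "ar (insert x (V - A)) (insert x (V - A)) = ar (V - A) (V - A) + 2 * card (N x \<inter> (V - A))"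
      using x fin by (intro arcs_between_insert symE irreflE) auto
    moreover have "ar (insert x (A - {x})) (insert x (A - {x})) = ar (A - {x}) (A - {x}) + 2 * card (N x \<inter> (A - {x}))"
      using x fin by (intro arcs_between_insert symE irreflE) auto
    moreover have "N x \<inter> (A - {x}) = N x \<inter> A" using irreflE by (auto simp: irrefl_def)
    moreover have "insert x (A - {x}) = A" using x by auto
    ultimately show ?thesis by simp
  qed
  moreover have "card (N x \<inter> (V - A)) \<le> card (N x \<inter> A)" if x: "x \<in> V - A" for x
  proof -
    have "?w A \<le> ?w (insert x A)" using A(1) x by (intro A(2)) auto
    moreover have "V - insert x A = (V - A) - {x}" by auto
    moreover have "ar (insert x A) (insert x A) = ar A A + 2 * card (N x \<inter> A)"
      using x fin by (intro arcs_between_insert symE irreflE) auto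
    moreover have "ar (insert x ((V - A) - {x})) (insert x ((V - A) - {x})) =
        ar ((V - A) - {x}) ((V - A) - {x}) + 2 * card (N x \<inter> ((V - A) - {x}))"
      using x fin by (intro arcs_between_insert symE irreflE) auto
    moreover have "N x \<inter> ((V - A) - {x}) = N x \<inter> (V - A)" using irreflE by (auto simp: irrefl_def)
    moreover have "insert x ((V - A) - {x}) = V - A" using x by auto
    ultimately show ?thesis by simp
  qed
  moreover have "?w A \<le> 4 * k * n" using A(2)[OF A0(1)] A0(2) by linarith
  ultimately show ?thesis using A(1) by (intro exI[of _ A]) simp
qed


text \<open>
  The threshold \<open>n / (32 k\<^sup>2)\<close> is small enough for any \<open>k + 1\<close> typical vertices of one side to have almost
  all of the other side as common neighbours, and large enough for only \<open>O(k\<^sup>3)\<close> vertices to be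
  atypical.
\<close>

definition atypical :: "'a set \<Rightarrow> 'a set \<Rightarrow> 'a set" where
  "atypical X Y = {x \<in> X. n < 32 * k\<^sup>2 * card (Y - N x)}"

end

section \<open>Structure of a dense graph along a maximum cut\<close>

locale hat_free_cut = hat_free +
  fixes A B :: "'a set"
  assumes AB: "A \<union> B = V" "A \<inter> B = {}"
    and big: "n\<^sup>2 \<le> 2 * card E"
    and few_inner: "ar A A + ar B B \<le> 4 * k * n"
    and maxA: "x \<in> A \<Longrightarrow> card (N x \<inter> A) \<le> card (N x \<inter> B)"
    and maxB: "x \<in> B \<Longrightarrow> card (N x \<inter> B) \<le> card (N x \<inter> A)"
begin

text \<open>Everything proved for \<open>A\<close> transfers to \<open>B\<close> by this
  symmetry.\<close>

lemma swap: "hat_free_cut V E k n B A"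
  using AB few_inner maxA maxB big by unfold_locales auto

lemma finAB: "finite A" "finite B"
  using AB(1) finV by (auto intro: finite_subset)

lemma card_AB: "n = card A + card B"
  using card_Un_disjoint[OF finAB AB(2)] AB(1) cardV by simp

lemma card_E_AB: "card E = ar A A + 2 * ar A B + ar B B"
  using arcs_between_Un[OF finAB AB(2) symE] AB(1) card_E by simp

lemma card_N_AB: "card (N x) = card (N x \<inter> A) + card (N x \<inter> B)"
proof -
  have "N x = (N x \<inter> A) \<union> (N x \<inter> B)" using N_sub AB(1) by blast
  then show ?thesis
    using card_Un_disjoint[of "N x \<inter> A" "N x \<inter> B"] finAB AB(2) by auto
qed

text \<open>The sum is \<open>card A * card B - ar A B\<close>. The product is at most
  \<open>n^2 / 4\<close>, while few inner arcs leave \<open>ar A B\<close> at least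
  \<open>n^2 / 4 - 2 k n\<close>.\<close>

lemma sum_missing: "(\<Sum>x\<in>A. card (B - N x)) \<le> 2 * k * n"
proof -
  have "card (B - N x) + card (N x \<inter> B) = card B" for x
    using card_Un_disjoint[of "B - N x" "N x \<inter> B"] finAB(2)
    by (metis Diff_disjoint Int_commute Un_Diff_Int card_Diff_subset_Int card_Int_Diff finite_Int add.commute)
  then have "(\<Sum>x\<in>A. card (B - N x)) + ar A B = card A * card B"
    by (simp add: arcs_between_sum[OF finAB] flip: sum.distrib)
  moreover have "4 * (card A * card B) \<le> n\<^sup>2"
  proof -
    have "0 \<le> (int (card A) - int (card B))\<^sup>2" by simp
    then have "int (4 * (card A * card B)) \<le> int (n\<^sup>2)"
      using card_AB by (simp add: power2_eq_square algebra_simps)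
    then show ?thesis by (simp only: of_nat_le_iff)
  qed
  ultimately show ?thesis using card_E_AB big few_inner by linarith
qed

text \<open>The squared difference of the sides is \<open>n^2 - 4 * card A * card B\<close>, at most
  \<open>8 k n\<close>; comparing squares then uses \<open>8192 k^5 \<le> n\<close>. If
  \<open>A\<close> is the larger side, the subtraction is 0.\<close>

lemma balanced: "32 * k\<^sup>2 * (card B - card A) \<le> n"
proof (cases "card A \<le> card B")
  case True
  let ?d = "card B - card A"
  have "2 * card E \<le> 4 * (card A * card B) + 8 * k * n"
    using card_E_AB few_inner arcs_between_le[OF finAB, of E] by linarith
  then have "n\<^sup>2 \<le> 4 * (card A * card B) + 8 * k * n" using big by linarith
  moreover have "n\<^sup>2 = ?d\<^sup>2 + 4 * (card A * card B)"
  proof -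
    have "card B = card A + ?d" using True by simp
    then have "n = 2 * card A + ?d" "card A * card B = card A * (card A + ?d)" using card_AB by auto
    then show ?thesis by (simp only:) (simp add: power2_eq_square algebra_simps)
  qed
  ultimately have d: "?d\<^sup>2 \<le> 8 * k * n" by linarith
  have "(32 * k\<^sup>2 * ?d)\<^sup>2 = 1024 * k ^ 4 * ?d\<^sup>2"
    by (simp add: power_mult_distrib flip: power_mult)
  also have "\<dots> \<le> 1024 * k ^ 4 * (8 * k * n)" using d by (rule mult_le_mono2)
  also have "\<dots> = (8192 * k ^ 5) * n" by (simp add: small_powers algebra_simps)
  also have "\<dots> \<le> n * n" using n_large'[of 5] by (intro mult_le_mono1) simp
  finally have "(32 * k\<^sup>2 * ?d)\<^sup>2 \<le> n\<^sup>2" by (simp only: power2_eq_square)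
  then show ?thesis by (rule power2_le_imp_le) simp
qed simp

text \<open>Each atypical vertex misses more than \<open>n / (32 k^2)\<close> vertices, out of a
  total of \<open>2 k n\<close> from \<open>sum_missing\<close>.\<close>

lemma card_atypical: "card (atypical A B) \<le> 64 * k ^ 3"
proof -
  have "n * card (atypical A B) \<le> (\<Sum>x \<in> atypical A B. 32 * k\<^sup>2 * card (B - N x))"
    using sum_bounded_below[of "atypical A B" n "\<lambda>x. 32 * k\<^sup>2 * card (B - N x)"]
    by (simp add: atypical_def mult.commute)
  also have "\<dots> \<le> (\<Sum>x \<in> A. 32 * k\<^sup>2 * card (B - N x))"
    using finAB by (intro sum_mono2) (auto simp: atypical_def)
  also have "\<dots> = 32 * k\<^sup>2 * (\<Sum>x \<in> A. card (B - N x))" by (simp add: sum_distrib_left)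
  also have "\<dots> \<le> 32 * k\<^sup>2 * (2 * k * n)" using sum_missing by (rule mult_le_mono2)
  also have "\<dots> = n * (64 * k ^ 3)" by (simp add: small_powers algebra_simps)
  finally show ?thesis using n_large'[of 0] by simp
qed

lemma typical_missing:
  assumes "x \<in> A - atypical A B" "Y \<subseteq> B"
  shows "32 * k\<^sup>2 * card (Y - N x) \<le> n"
proof -
  have "card (Y - N x) \<le> card (B - N x)" using assms(2) finAB by (intro card_mono) auto
  then have "32 * k\<^sup>2 * card (Y - N x) \<le> 32 * k\<^sup>2 * card (B - N x)" by (rule mult_le_mono2)
  also have "\<dots> \<le> n" using assms(1) by (auto simp: atypical_def)
  finally show ?thesis .
qed

text \<open>\<open>A\<close> has at least \<open>n / 2 - n / 64\<close> vertices by
  \<open>balanced\<close> and loses at most \<open>n / 256\<close>.\<close>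

lemma core_large: "n \<le> 4 * card (A - atypical A B)"
proof -
  have "card (A - atypical A B) = card A - card (atypical A B)"
    using finAB by (intro card_Diff_subset) (auto simp: atypical_def)
  then have 1: "card A \<le> card (A - atypical A B) + 64 * k ^ 3" using card_atypical by linarith
  have "16384 * k ^ 3 \<le> n" using n_large'[of 3] by simp
  moreover have "32 * (card B - card A) \<le> n"
  proof -
    have "32 * 1 * (card B - card A) \<le> 32 * k\<^sup>2 * (card B - card A)"
      using k1 by (intro mult_le_mono1 mult_le_mono2) simp
    then show ?thesis using balanced by linarith
  qed
  ultimately show ?thesis using 1 card_AB by linarith
qed

text \<open>At least \<open>k\<close> of the inner neighbours of \<open>x\<close> are typical.
  Within \<open>N x \<inter> B\<close>, their common neighbours number at most
  \<open>2 * k + 1\<close> by \<open>complete_pair_small\<close>, and the others at most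
  \<open>n / (32 k)\<close>.\<close>

lemma cross_degree:
  assumes "x \<in> A" "k + 64 * k ^ 3 \<le> card (N x \<inter> A)"
  shows "32 * k\<^sup>2 * card (N x \<inter> B) \<le> 32 * k\<^sup>2 * (2 * k + 1) + k * n"
proof -
  have "card (N x \<inter> A) \<le> card (N x \<inter> A - atypical A B) + card (atypical A B)"
    using diff_card_le_card_Diff[of "atypical A B" "N x \<inter> A"] finAB
    by (auto simp: atypical_def)
  then have "k \<le> card (N x \<inter> A - atypical A B)" using assms(2) card_atypical by linarith
  then obtain P where P: "P \<subseteq> N x \<inter> A - atypical A B" "card P = k" "finite P"
    using obtain_subset_with_card_n by metis
  let ?Y = "N x \<inter> B"
  let ?R = "{y \<in> ?Y. \<exists>p \<in> P. y \<notin> N p}"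
  have "32 * k\<^sup>2 * card ?R \<le> card P * n"
    using P finAB typical_missing by (intro common_neighbours) auto
  moreover have "card (?Y - ?R) \<le> 2 * k + 1"
  proof (rule complete_pair_small)
    show "x \<in> V" using assms(1) AB by blast
    show "P \<inter> (?Y - ?R) = {}" using P(1) AB(2) by blast
    show "P \<times> (?Y - ?R) \<subseteq> E" by auto
  qed (use P in auto)
  moreover have "card ?Y = card (?Y - ?R) + card ?R"
    using finAB by (intro card_Diff_plus) auto
  ultimately have "32 * k\<^sup>2 * card ?R \<le> k * n" "card ?Y \<le> (2 * k + 1) + card ?R" using P(2) by auto
  then have "32 * k\<^sup>2 * card ?Y \<le> 32 * k\<^sup>2 * ((2 * k + 1) + card ?R)" by (intro mult_le_mono2)
  also have "\<dots> \<le> 32 * k\<^sup>2 * (2 * k + 1) + k * n"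
    using \<open>32 * k\<^sup>2 * card ?R \<le> k * n\<close> by (simp add: distrib_left)
  finally show ?thesis .
qed

text \<open>With many inner neighbours \<open>cross_degree\<close> applies, and in a maximum cut the
  inner degree is at most the cross degree. With few, the more than \<open>n / (32 k^2)\<close>
  missing vertices of \<open>B\<close> outweigh the inner degree and the imbalance. The slack
  \<open>128 * k ^ 3\<close> bounds the number of atypical vertices on both sides, so the degree is
  at most half the number of typical ones.\<close>

lemma atypical_degree:
  assumes "z \<in> atypical A B"
  shows "2 * card (N z) + 128 * k ^ 3 \<le> n"
proof (cases "k + 64 * k ^ 3 \<le> card (N z \<inter> A)")
  case True
  have zA: "z \<in> A" using assms by (simp add: atypical_def)
  let ?d = "card (N z \<inter> B)"
  have "card (N z) \<le> 2 * ?d" using card_N_AB[of z] maxA[OF zA] by simp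
  moreover have "4 * ?d + 128 * k ^ 3 \<le> n"
  proof (rule ccontr)
    assume "\<not> 4 * ?d + 128 * k ^ 3 \<le> n"
    then have "32 * k\<^sup>2 * n \<le> 32 * k\<^sup>2 * (4 * ?d + 128 * k ^ 3)" by (intro mult_le_mono2) simp
    also have "\<dots> = 4 * (32 * k\<^sup>2 * ?d) + 4096 * k ^ 5" by (simp add: small_powers algebra_simps)
    also have "\<dots> \<le> 4 * (32 * k\<^sup>2 * (2 * k + 1) + k * n) + 4096 * k ^ 5"
      by (intro add_mono mult_le_mono2 cross_degree[OF zA True]) simp
    also have "\<dots> = 256 * k ^ 3 + 128 * k ^ 2 + 4096 * k ^ 5 + 4 * (k * n)"
      by (simp add: small_powers algebra_simps)
    also have "\<dots> \<le> 4480 * k ^ 5 + 4 * (k\<^sup>2 * n)"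
    proof -
      have "k ^ 3 \<le> k ^ 5" "k ^ 2 \<le> k ^ 5" "k * n \<le> k\<^sup>2 * n"
        using k1 by (simp_all only: power_increasing) (simp add: power2_eq_square)
      then show ?thesis by linarith
    qed
    finally have "28 * (k\<^sup>2 * n) \<le> 4480 * k ^ 5" by linarith
    moreover have "n \<le> k\<^sup>2 * n" using k1 by simp
    moreover have "16384 * k ^ 5 \<le> n" by (rule n_large') simp
    moreover have "0 < k ^ 5" using k1 by simp
    ultimately show False by linarith
  qed
  ultimately show ?thesis by linarith
next
  case False
  let ?m = "card (B - N z)" and ?D = "card B - card A"
  have m: "n < 32 * k\<^sup>2 * ?m" using assms by (simp add: atypical_def)
  \<comment> \<open>Twice the inner degree is below \<open>2 * k + 128 * k ^ 3\<close>, the slack is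
    another \<open>128 * k ^ 3\<close>, and \<open>2 * card B\<close> exceeds \<open>n\<close> by at
    most \<open>?D\<close>.\<close>
  have "2 * k + 256 * k ^ 3 + ?D \<le> 2 * ?m"
  proof (rule ccontr)
    assume "\<not> 2 * k + 256 * k ^ 3 + ?D \<le> 2 * ?m"
    then have "32 * k\<^sup>2 * (2 * ?m) \<le> 32 * k\<^sup>2 * (2 * k + 256 * k ^ 3 + ?D)"
      by (intro mult_le_mono2) simp
    also have "\<dots> = 64 * k ^ 3 + 8192 * k ^ 5 + 32 * k\<^sup>2 * ?D"
      by (simp add: small_powers algebra_simps)
    finally have "2 * (32 * k\<^sup>2 * ?m) \<le> 64 * k ^ 3 + 8192 * k ^ 5 + n" using balanced by linarith
    moreover have "k ^ 3 \<le> k ^ 5" using k1 by (intro power_increasing) auto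
    moreover have "16384 * k ^ 5 \<le> n" by (rule n_large') simp
    ultimately show False using m by linarith
  qed
  moreover have "card B = ?m + card (N z \<inter> B)"
    using card_Int_Diff[OF finAB(2), of "N z"] by (simp add: Int_commute)
  moreover have "2 * card B \<le> n + ?D" using card_AB by linarith
  ultimately show ?thesis using False card_N_AB[of z] by linarith
qed

text \<open>\<open>x\<close> is inserted so that the vertices of \<open>Y\<close> left over also lie
  in \<open>N x\<close>, where the sparseness assumptions apply.\<close>

lemma common_core:
  assumes "x \<in> A - atypical A B" "P \<subseteq> N x \<inter> (A - atypical A B)" "Y \<subseteq> B"
  shows "32 * k\<^sup>2 * card {y \<in> Y. \<exists>p \<in> insert x P. y \<notin> N p} \<le> (card P + 1) * n"
proof -
  have "finite P" using assms(2) finAB by (auto intro: finite_subset)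
  then have "32 * k\<^sup>2 * card {y \<in> Y. \<exists>p \<in> insert x P. y \<notin> N p} \<le> card (insert x P) * n"
    using assms finAB by (intro common_neighbours typical_missing) (auto intro: finite_subset)
  also have "\<dots> \<le> (card P + 1) * n"
    using card_insert_le_m1[of "card P + 1" P x] by (intro mult_le_mono1) simp
  finally show ?thesis .
qed

text \<open>Otherwise \<open>x\<close> and \<open>k\<close> typical inner neighbours share almost
  all typical vertices of \<open>B\<close>, a complete pair too large for
  \<open>complete_pair_small\<close>.\<close>

lemma core_degree:
  assumes x: "x \<in> A - atypical A B"
  shows "card (N x \<inter> (A - atypical A B)) \<le> k - 1"
proof (rule ccontr)
  assume "\<not> ?thesis"
  then have "k \<le> card (N x \<inter> (A - atypical A B))" by simp
  then obtain P where P: "P \<subseteq> N x \<inter> (A - atypical A B)" "card P = k" "finite P"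
    using obtain_subset_with_card_n by metis
  let ?Y = "B - atypical B A"
  let ?R = "{y \<in> ?Y. \<exists>p \<in> insert x P. y \<notin> N p}"
  have R: "32 * k\<^sup>2 * card ?R \<le> (k + 1) * n"
    using common_core[OF x P(1), of ?Y] P(2) by auto
  have Q: "card (?Y - ?R) \<le> 2 * k + 1"
  proof (rule complete_pair_small)
    show "x \<in> V" using x AB by blast
    show "P \<inter> (?Y - ?R) = {}" using P(1) AB(2) by blast
    show "P \<times> (?Y - ?R) \<subseteq> E" by auto
  qed (use P in auto)
  have "n \<le> 4 * card ?Y" using hat_free_cut.core_large[OF swap] .
  also have "card ?Y = card (?Y - ?R) + card ?R"
    using finAB by (intro card_Diff_plus) auto
  also have "4 * (card (?Y - ?R) + card ?R) \<le> 4 * ((2 * k + 1) + card ?R)"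
    using Q by (intro mult_le_mono2 add_mono) simp_all
  finally have "n \<le> 4 * (2 * k + 1) + 4 * card ?R" by (simp only: distrib_left)
  then have "32 * k\<^sup>2 * n \<le> 32 * k\<^sup>2 * (4 * (2 * k + 1) + 4 * card ?R)" by (rule mult_le_mono2)
  also have "\<dots> = 256 * k ^ 3 + 128 * k\<^sup>2 + 4 * (32 * k\<^sup>2 * card ?R)"
    by (simp add: small_powers algebra_simps)
  also have "\<dots> \<le> 256 * k ^ 3 + 128 * k\<^sup>2 + 4 * ((k + 1) * n)" using R by linarith
  also have "\<dots> \<le> 384 * k ^ 3 + 8 * (k\<^sup>2 * n)"
  proof -
    have "k ^ 2 \<le> k ^ 3" using k1 by (intro power_increasing) auto
    moreover have "(k + 1) * n \<le> (2 * k\<^sup>2) * n"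
    proof (rule mult_le_mono1)
      have "k \<le> k\<^sup>2" "1 \<le> k\<^sup>2" using k1 by (auto simp: power2_eq_square)
      then show "k + 1 \<le> 2 * k\<^sup>2" by linarith
    qed
    ultimately show ?thesis by simp
  qed
  finally have "24 * (k\<^sup>2 * n) \<le> 384 * k ^ 3" by linarith
  moreover have "n \<le> k\<^sup>2 * n" using k1 by simp
  moreover have "16384 * k ^ 3 \<le> n" by (rule n_large') simp
  moreover have "0 < k ^ 3" using k1 by simp
  ultimately show False by linarith
qed

text \<open>The inner neighbours of \<open>x\<close> are completely joined to the common neighbours
  \<open>Q\<close> on the other side, so \<open>sparse_part\<close> gives average degree at most
  \<open>b - 1\<close> on \<open>Q - U\<close>. A further 1/2 pays for the vertices put back, each
  of inner degree at most \<open>k - 1\<close>.\<close>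

lemma core_tradeoff:
  assumes x: "x \<in> A - atypical A B" and a: "1 \<le> card (N x \<inter> (A - atypical A B))"
    and ab: "card (N x \<inter> (A - atypical A B)) + b = k"
  shows "2 * ar (B - atypical B A) (B - atypical B A) \<le> (2 * b - 1) * card (B - atypical B A)"
proof -
  let ?P = "N x \<inter> (A - atypical A B)"
  let ?Y = "B - atypical B A"
  let ?R = "{y \<in> ?Y. \<exists>p \<in> insert x ?P. y \<notin> N p}"
  let ?Q = "?Y - ?R"
  have b: "1 \<le> b" using core_degree[OF x] ab k1 by linarith
  have finY: "finite ?Y" using finAB by simp
  obtain U where U: "U \<subseteq> ?Q" "card U \<le> 2 * k + 1"
    "int (ar (?Q - U) (?Q - U)) \<le> (int b - 1) * int (card (?Q - U))"
  proof -
    have "\<exists>U \<subseteq> ?Q. card U \<le> 2 * k + 1 \<and>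
        int (ar (?Q - U) (?Q - U)) \<le> (int b - 1) * int (card (?Q - U))"
    proof (rule sparse_part[OF _ _ _ _ _ a ab])
      show "x \<in> V" using x AB by blast
      show "?P \<inter> ?Q = {}" using AB(2) by blast
      show "?P \<times> ?Q \<subseteq> E" by auto
    qed auto
    then show thesis using that by blast
  qed
  let ?S = "?Q - U"
  let ?w = "card (?Y - ?S)"
  have "card (?Y - ?S) \<le> card ?R + card U"
  proof -
    have "?Y - ?S \<subseteq> ?R \<union> U" by blast
    moreover have "finite (?R \<union> U)" using U(1) finY by (auto intro: finite_subset)
    ultimately have "card (?Y - ?S) \<le> card (?R \<union> U)" by (intro card_mono)
    then show ?thesis using card_Un_le[of ?R U] by linarith
  qed
  then have w: "?w \<le> card ?R + (2 * k + 1)" using U(2) by linarith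
  have R: "32 * k\<^sup>2 * card ?R \<le> k * n"
  proof -
    have "32 * k\<^sup>2 * card ?R \<le> (card ?P + 1) * n" by (rule common_core[OF x]) auto
    also have "\<dots> \<le> k * n" using ab b by (intro mult_le_mono1) simp
    finally show ?thesis .
  qed
  have "ar ?Y ?Y \<le> ar ?S ?S + 2 * ar (?Y - ?S) ?Y"
    using finY by (intro arcs_between_remove symE) auto
  moreover have "ar (?Y - ?S) ?Y \<le> (k - 1) * ?w"
    using finY hat_free_cut.core_degree[OF swap] by (intro arcs_between_le_degree) auto
  moreover have "ar ?S ?S \<le> (b - 1) * card ?Y"
  proof -
    have "int (ar ?S ?S) \<le> int ((b - 1) * card ?S)" using U(3) b by (simp add: of_nat_diff)
    then have "ar ?S ?S \<le> (b - 1) * card ?S" by (simp only: of_nat_le_iff)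
    also have "\<dots> \<le> (b - 1) * card ?Y" using finY by (intro mult_le_mono2 card_mono) auto
    finally show ?thesis .
  qed
  ultimately have main: "2 * ar ?Y ?Y \<le> 2 * ((b - 1) * card ?Y) + 4 * ((k - 1) * ?w)" by linarith
  \<comment> \<open>\<open>?R\<close> has at most \<open>n / (32 k)\<close> vertices, so the left
    side is at most about \<open>n / 8\<close>, while \<open>?Y\<close> has at least
    \<open>n / 4\<close> vertices.\<close>
  have "4 * ((k - 1) * ?w) \<le> card ?Y"
  proof (rule ccontr)
    assume "\<not> ?thesis"
    moreover have "(k - 1) * ?w \<le> k * ?w" by (intro mult_le_mono1) simp
    moreover have "n \<le> 4 * card ?Y" using hat_free_cut.core_large[OF swap] .
    ultimately have "n \<le> 16 * (k * ?w)" by linarith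
    then have "2 * k * n \<le> 2 * k * (16 * (k * ?w))" by (rule mult_le_mono2)
    also have "\<dots> = 32 * k\<^sup>2 * ?w" by (simp add: power2_eq_square)
    also have "\<dots> \<le> 32 * k\<^sup>2 * (card ?R + (2 * k + 1))" using w by (rule mult_le_mono2)
    also have "\<dots> = 32 * k\<^sup>2 * card ?R + 64 * k ^ 3 + 32 * k\<^sup>2"
      by (simp add: small_powers algebra_simps)
    finally have "k * n \<le> 64 * k ^ 3 + 32 * k\<^sup>2" using R by linarith
    moreover have "n \<le> k * n" using k1 by simp
    moreover have "16384 * k ^ 3 \<le> n" by (rule n_large') simp
    moreover have "k ^ 2 \<le> k ^ 3" using k1 by (intro power_increasing) auto
    moreover have "0 < k ^ 3" using k1 by simp
    ultimately show False by linarith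
  qed
  moreover have "2 * ((b - 1) * card ?Y) + card ?Y = (2 * b - 1) * card ?Y"
    using b by (cases b) (auto simp: algebra_simps)
  ultimately show ?thesis using main by linarith
qed

text \<open>
  Let \<open>a\<close> and \<open>a'\<close> be the maximum inner degrees of the two sides. If \<open>a + a' < k\<close>, the bounds \<open>a |X|\<close> and
  \<open>a' |Y|\<close> suffice; otherwise add up \<open>(k - a - 1/2) |Y|\<close> and \<open>(k - a' - 1/2) |X|\<close>.
\<close>

lemma core_inner_arcs:
  "ar (A - atypical A B) (A - atypical A B) + ar (B - atypical B A) (B - atypical B A)
    \<le> (k - 1) * max (card (A - atypical A B)) (card (B - atypical B A))"
proof -
  interpret sw: hat_free_cut V E k n B A by (rule swap)
  let ?X = "A - atypical A B" and ?Y = "B - atypical B A"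
  let ?M = "max (card ?X) (card ?Y)"
  have fin: "finite ?X" "finite ?Y" using finAB by auto
  have "0 < card ?X" "0 < card ?Y" using core_large sw.core_large n_large'[of 0] by auto
  then have ne: "?X \<noteq> {}" "?Y \<noteq> {}" unfolding card_gt_0_iff by blast+
  obtain x where x: "x \<in> ?X" "\<And>y. y \<in> ?X \<Longrightarrow> card (N y \<inter> ?X) \<le> card (N x \<inter> ?X)"
    using finite_ex_max[OF fin(1) ne(1), of "\<lambda>y. card (N y \<inter> ?X)"] by blast
  obtain y where y: "y \<in> ?Y" "\<And>x. x \<in> ?Y \<Longrightarrow> card (N x \<inter> ?Y) \<le> card (N y \<inter> ?Y)"
    using finite_ex_max[OF fin(2) ne(2), of "\<lambda>y. card (N y \<inter> ?Y)"] by blast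
  define a where "a = card (N x \<inter> ?X)"
  define a' where "a' = card (N y \<inter> ?Y)"
  have le: "a \<le> k - 1" "a' \<le> k - 1"
    using core_degree[OF x(1)] sw.core_degree[OF y(1)] by (simp_all add: a_def a'_def)
  have "ar ?X ?X \<le> a * card ?X" "ar ?Y ?Y \<le> a' * card ?Y"
    using x(2) y(2) fin by (auto intro!: arcs_between_le_degree simp: a_def a'_def)
  then have 1: "ar ?X ?X \<le> a * ?M" "ar ?Y ?Y \<le> a' * ?M"
    by (meson le_trans max.cobounded1 max.cobounded2 mult_le_mono2)+
  show ?thesis
  proof (cases "a + a' \<le> k - 1")
    case True
    have "ar ?X ?X + ar ?Y ?Y \<le> (a + a') * ?M" using 1 by (simp add: distrib_right)
    also have "\<dots> \<le> (k - 1) * ?M" using True by (rule mult_le_mono1)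
    finally show ?thesis .
  next
    case False
    \<comment> \<open>Here \<open>a + a' \<ge> k\<close> with both at most \<open>k - 1\<close>, so
      both are positive, as \<open>core_tradeoff\<close> requires.\<close>
    have "2 * ar ?Y ?Y \<le> (2 * (k - a) - 1) * card ?Y"
      using False le k1 by (intro core_tradeoff[OF x(1)]) (auto simp: a_def[symmetric])
    also have "\<dots> \<le> (2 * (k - a) - 1) * ?M" by (intro mult_le_mono2) simp
    finally have Y: "2 * ar ?Y ?Y \<le> (2 * (k - a) - 1) * ?M" .
    have "2 * ar ?X ?X \<le> (2 * (k - a') - 1) * card ?X"
      using False le k1 by (intro sw.core_tradeoff[OF y(1)]) (auto simp: a'_def[symmetric])
    also have "\<dots> \<le> (2 * (k - a') - 1) * ?M" by (intro mult_le_mono2) simp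
    finally have X: "2 * ar ?X ?X \<le> (2 * (k - a') - 1) * ?M" .
    have "2 * (ar ?X ?X + ar ?Y ?Y) \<le> ((2 * (k - a) - 1) + (2 * (k - a') - 1)) * ?M"
      using X Y by (simp add: distrib_right)
    also have "\<dots> \<le> (2 * (k - 1)) * ?M" using False le k1 by (intro mult_le_mono1) linarith
    finally show ?thesis by simp
  qed
qed

lemma card_E_le: "card E \<le> 2 * f_bound n k"
proof -
  interpret sw: hat_free_cut V E k n B A by (rule swap)
  let ?X = "A - atypical A B" and ?Y = "B - atypical B A"
  let ?S = "?X \<union> ?Y" and ?Z = "atypical A B \<union> atypical B A"
  have fin: "finite ?X" "finite ?Y" "finite ?Z" using finAB by (auto simp: atypical_def)
  have dis: "?X \<inter> ?Y = {}" using AB(2) by blast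
  have VS: "V - ?S = ?Z" and SV: "?S \<subseteq> V" and SZ: "V = ?S \<union> ?Z" "?S \<inter> ?Z = {}"
    using AB by (auto simp: atypical_def)
  have cS: "card ?S = card ?X + card ?Y" using fin(1,2) dis by (rule card_Un_disjoint)
  have n: "n = card ?S + card ?Z"
    using card_Un_disjoint[OF _ fin(3) SZ(2)] fin(1,2) SZ(1) cardV by simp
  have z: "card ?Z \<le> 128 * k ^ 3"
    using card_Un_le[of "atypical A B" "atypical B A"] card_atypical sw.card_atypical by linarith
  have "ar ?Z V \<le> (card ?S div 2) * card ?Z"
  proof (rule arcs_between_le_degree[OF fin(3) finV])
    fix x assume "x \<in> ?Z"
    then have "2 * card (N x) + 128 * k ^ 3 \<le> n" using atypical_degree sw.atypical_degree by blast
    then have "card (N x) \<le> card ?S div 2" using n z by linarith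
    then show "card (N x \<inter> V) \<le> card ?S div 2" using N_sub by (simp add: Int_absorb2)
  qed
  then have "2 * ar ?Z V \<le> (2 * (card ?S div 2)) * card ?Z" by simp
  also have "\<dots> \<le> card ?S * card ?Z" by (intro mult_le_mono1) simp
  finally have Z: "2 * ar ?Z V \<le> card ?Z * card ?S" by (simp add: mult.commute)
  have S: "ar ?S ?S \<le> 2 * f_bound (card ?S) k"
  proof -
    let ?p = "max (card ?X) (card ?Y)" and ?q = "min (card ?X) (card ?Y)"
    have "ar ?S ?S = ar ?X ?X + 2 * ar ?X ?Y + ar ?Y ?Y"
      using fin dis symE by (intro arcs_between_Un) auto
    moreover have "ar ?X ?Y \<le> ?p * ?q"
      using arcs_between_le[OF fin(1,2), of E] by (auto simp: max_def min_def mult.commute)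
    ultimately have le: "ar ?S ?S \<le> 2 * (?p * ?q) + (k - 1) * ?p" using core_inner_arcs by linarith
    \<comment> \<open>Arcs come in pairs, so halving the bound may round down, matching the floor in
      \<open>f_bound\<close>.\<close>
    have "even (ar ?S ?S)"
    proof -
      have "pair_graph \<lparr>pverts = ?S, parcs = E \<inter> ?S \<times> ?S\<rparr>"
        using fin symE irreflE by (auto simp: pair_graph_iff sym_def irrefl_def)
      from card_parcs[OF this] show ?thesis by (simp add: arcs_between_def)
    qed
    then have "ar ?S ?S \<le> 2 * (?p * ?q + ((k - 1) * ?p) div 2)" using le by presburger
    also have "\<dots> \<le> 2 * f_bound (card ?S) k"
      using cS by (intro mult_le_mono2 f_bound_ge) auto
    finally show ?thesis .
  qed
  have "card E \<le> ar ?S ?S + 2 * ar ?Z V"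
    using arcs_between_remove[OF finV SV symE] VS card_E by simp
  also have "\<dots> \<le> 2 * f_bound (card ?S) k + card ?Z * card ?S" using S Z by linarith
  also have "\<dots> \<le> 2 * f_bound (card ?S + card ?Z) k" by (rule f_bound_add)
  finally show ?thesis using n by simp
qed

end

lemma (in hat_free) card_arcs_le: "card E \<le> 2 * f_bound n k"
proof (cases "n\<^sup>2 \<le> 2 * card E")
  case True
  obtain A where A: "A \<subseteq> V" "ar A A + ar (V - A) (V - A) \<le> 4 * k * n"
    "\<forall>x \<in> A. card (N x \<inter> A) \<le> card (N x \<inter> (V - A))"
    "\<forall>x \<in> V - A. card (N x \<inter> (V - A)) \<le> card (N x \<inter> A)"
    using max_cut[OF True] by blast
  interpret hat_free_cut V E k n A "V - A"
    using A True by unfold_locales auto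
  show ?thesis by (rule card_E_le)
next
  case False
  then show ?thesis using f_bound_square[of n k] by linarith
qed

section \<open>Suspensions and the extremal number\<close>

lemma contains_suspension:
  assumes "pair_graph G" "pair_graph H" "v \<in> pverts G"
    and "embeds (pverts H) (parcs H) (parcs G `` {v}) (parcs G)"
  shows "contains_copy G (suspension H)"
proof -
  obtain h where h: "inj_on h (pverts H)" "h ` pverts H \<subseteq> parcs G `` {v}"
    "\<forall>u \<in> pverts H. \<forall>w \<in> pverts H. (u, w) \<in> parcs H \<longrightarrow> (h u, h w) \<in> parcs G"
    using assms(4) by (rule embedsE)
  let ?h = "case_option v h"
  have G: "parcs G \<subseteq> pverts G \<times> pverts G" "sym (parcs G)" "irrefl (parcs G)"
    and H: "parcs H \<subseteq> pverts H \<times> pverts H"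
    using assms(1,2) by (auto simp: pair_graph_iff)
  have hv: "(v, h u) \<in> parcs G" "(h u, v) \<in> parcs G" "h u \<noteq> v" "h u \<in> pverts G" if "u \<in> pverts H" for u
  proof -
    show *: "(v, h u) \<in> parcs G" using h(2) that by auto
    then show "(h u, v) \<in> parcs G" using G(2) by (auto dest: symD)
    show "h u \<noteq> v" using * G(3) by (auto simp: irrefl_def)
    show "h u \<in> pverts G" using * G(1) by auto
  qed
  have "inj_on ?h (pverts (suspension H))"
    using h(1) hv(3) by (auto simp: suspension_def inj_on_def)
  moreover have "?h ` pverts (suspension H) \<subseteq> pverts G"
    using assms(3) hv(4) by (auto simp: suspension_def)
  moreover have "\<forall>(u, w) \<in> parcs (suspension H). (?h u, ?h w) \<in> parcs G"
    using h(3) hv(1,2) H by (auto simp: suspension_def)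
  ultimately show ?thesis
    unfolding contains_copy_iff[OF assms(1) pair_graph_suspension[OF assms(2)]] by blast
qed

lemma suspension_embeds:
  assumes "pair_graph G" "pair_graph H" "contains_copy G (suspension H)"
  shows "\<exists>v \<in> pverts G. embeds (pverts H) (parcs H) (parcs G `` {v}) (parcs G)"
proof -
  obtain h where h: "inj_on h (pverts (suspension H))" "h ` pverts (suspension H) \<subseteq> pverts G"
    "\<forall>(u, w) \<in> parcs (suspension H). (h u, h w) \<in> parcs G"
    using assms(3) unfolding contains_copy_iff[OF assms(1) pair_graph_suspension[OF assms(2)]] by blast
  have "h None \<in> pverts G" using h(2) by (auto simp: suspension_def)
  moreover have "embeds (pverts H) (parcs H) (parcs G `` {h None}) (parcs G)"
  proof (rule embedsI[of "h \<circ> Some"])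
    show "inj_on (h \<circ> Some) (pverts H)"
      using h(1) by (auto simp: suspension_def inj_on_def)
    show "(h \<circ> Some) ` pverts H \<subseteq> parcs G `` {h None}"
      using h(3) by (auto simp: suspension_def)
    show "((h \<circ> Some) u, (h \<circ> Some) v) \<in> parcs G" if "(u, v) \<in> parcs H" for u v
      using h(3) that by (auto simp: suspension_def)
  qed
  ultimately show ?thesis by blast
qed

lemma ex_number_le:
  assumes "pair_graph H" "parcs H \<noteq> {}"
    and "\<And>G :: nat pair_pre_digraph. pair_graph G \<Longrightarrow> card (pverts G) = n \<Longrightarrow> \<not> contains_copy G H \<Longrightarrow>
      card (edges G) \<le> m"
  shows "ex_number n H \<le> m"
  unfolding ex_number_def
  by (intro Max.boundedI finite_ex_set ex_set_nonempty assms(1,2)) (use assms(3) in blast)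

lemma ex_number_ge:
  fixes G :: "nat pair_pre_digraph"
  assumes "pair_graph G" "card (pverts G) = n" "\<not> contains_copy G H"
  shows "card (edges G) \<le> ex_number n H"
  unfolding ex_number_def using assms by (intro Max_ge finite_ex_set) blast

text \<open>A violation of either sparseness assumption of \<open>hat_free\<close> embeds
  \<open>T\<close> into a neighbourhood: for \<open>sparse_nbhd\<close> with \<open>T\<close> as a
  subtree of itself, for \<open>sparse_part\<close> by \<open>tree_embeds\<close>.\<close>

lemma ex_number_suspension_le:
  fixes T :: "'a pair_pre_digraph"
  assumes k: "1 \<le> k" and T: "undirected_tree T"
    and size: "2 * k \<le> card (pverts T)" "card (pverts T) \<le> 2 * k + 1"
    and es: "\<forall>T'. subgraph (with_proj T') (with_proj T) \<and> undirected_tree T' \<longrightarrow> erdos_sos_holds T'"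
    and n: "4 * (4 * k) ^ 6 \<le> n"
  shows "ex_number n (suspension T) \<le> f_bound n k"
proof (rule ex_number_le)
  have gT: "pair_graph T" using T by (simp add: undirected_tree_def)
  then show "pair_graph (suspension T)" by (rule pair_graph_suspension)
  have ne: "pverts T \<noteq> {}" using size(1) k by auto
  then show "parcs (suspension T) \<noteq> {}" by (auto simp: suspension_def)
  fix G :: "nat pair_pre_digraph"
  assume G: "pair_graph G" "card (pverts G) = n" "\<not> contains_copy G (suspension T)"
  let ?E = "parcs G"
  have g: "finite (pverts G)" "?E \<subseteq> pverts G \<times> pverts G" "sym ?E" "irrefl ?E"
    using G(1) by (auto simp: pair_graph_iff)
  have free: "\<not> embeds (pverts T) (parcs T) (?E `` {v}) ?E" if "v \<in> pverts G" for v
    using contains_suspension[OF G(1) gT that] G(3) by blast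
  have fin: "finite (?E `` {v})" for v
  proof -
    have "?E `` {v} \<subseteq> pverts G" using g(2) by auto
    then show ?thesis using g(1) by (rule finite_subset)
  qed
  have "hat_free (pverts G) ?E k n"
  proof
    show "arcs_between ?E (?E `` {v}) (?E `` {v}) \<le> (2 * k - 1) * card (?E `` {v})"
      if v: "v \<in> pverts G" for v
    proof (rule ccontr)
      assume *: "\<not> ?thesis"
      have "(int (card (pverts T)) - 2) * int (card (?E `` {v})) \<le> int ((2 * k - 1) * card (?E `` {v}))"
        unfolding of_nat_mult using size(2) k by (intro mult_right_mono) auto
      also have "\<dots> < int (card (?E \<inter> (?E `` {v}) \<times> (?E `` {v})))"
        using * by (simp only: arcs_between_def of_nat_less_iff not_le)
      finally have d: "(int (card (pverts T)) - 2) * int (card (?E `` {v})) < \<dots>" .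
      have sub: "parcs T \<inter> pverts T \<times> pverts T = parcs T" using gT by (auto simp: pair_graph_iff)
      have conn: "(x, y) \<in> (parcs T \<inter> pverts T \<times> pverts T)\<^sup>*" if "x \<in> pverts T" "y \<in> pverts T" for x y
        unfolding sub using T that connected_iff_rtrancl[OF gT] by (simp add: undirected_tree_def)
      have "embeds (pverts T) (parcs T) (?E `` {v}) ?E"
        using erdos_sos_embeds[OF T es subset_refl ne conn fin g(3,4) d] by blast
      then show False using free[OF v] by blast
    qed
    show "\<exists>U \<subseteq> Q. card U \<le> 2 * k + 1 \<and>
        int (arcs_between ?E (Q - U) (Q - U)) \<le> (int b - 1) * int (card (Q - U))"
      if *: "v \<in> pverts G" "P \<subseteq> ?E `` {v}" "Q \<subseteq> ?E `` {v}" "P \<inter> Q = {}" "P \<times> Q \<subseteq> ?E"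
        "1 \<le> a" "a + b = k" "a \<le> card P" for v P Q a b
    proof (rule ccontr)
      assume neg: "\<not> ?thesis"
      have "embeds (pverts T) (parcs T) (P \<union> Q) ?E"
      proof (rule tree_embeds[OF T es _ _ _ _ g(3,4) *(4,8,5)])
        show "2 * b + 2 \<le> card (pverts T)" "card (pverts T) \<le> 2 * a + 2 * b + 1"
          using size *(6,7) by auto
        show "finite P" "finite Q" using *(2,3) fin by (auto intro: finite_subset)
        show "(int b - 1) * int (card (Q - U)) < int (card (?E \<inter> (Q - U) \<times> (Q - U)))"
          if "U \<subseteq> Q" "card U \<le> card (pverts T)" for U
          using neg that size(2) unfolding arcs_between_def by (meson le_trans not_le)
      qed
      then obtain h where "inj_on h (pverts T)" "h ` pverts T \<subseteq> P \<union> Q"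
        "\<forall>u \<in> pverts T. \<forall>v \<in> pverts T. (u, v) \<in> parcs T \<longrightarrow> (h u, h v) \<in> ?E"
        by (rule embedsE)
      then have "embeds (pverts T) (parcs T) (?E `` {v}) ?E"
        using *(2,3) by (intro embedsI[of h]) auto
      then show False using free[OF *(1)] by blast
    qed
  qed (use g G(2) k n in auto)
  then have "card ?E \<le> 2 * f_bound n k" by (rule hat_free.card_arcs_le)
  then show "card (edges G) \<le> f_bound n k" using card_parcs[OF G(1)] by simp
qed

section \<open>Extremal graphs\<close>

text \<open>
  The last disjunct puts copies of \<open>K\<^bsub>d,d\<^esub>\<close> on the blocks of \<open>2 * d\<close> consecutive vertices below \<open>p\<close>,
  split by parity. For \<open>d = 0\<close> all vertices would lie in one block, as \<open>x div 0 = 0\<close>, hence \<open>0 < d\<close>.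
\<close>

definition extremal_arcs :: "nat \<Rightarrow> nat \<Rightarrow> nat \<Rightarrow> (nat \<times> nat) set" where
  "extremal_arcs d p n =
     {(x, y). x < p \<and> p \<le> y \<and> y < n \<or> y < p \<and> p \<le> x \<and> x < n \<or>
              x < p \<and> y < p \<and> 0 < d \<and> x div (2 * d) = y div (2 * d) \<and> (even x \<longleftrightarrow> odd y)}"

lemma card_block_neighbours:
  fixes x :: nat
  assumes "0 < d"
  shows "card {y. x div (2 * d) = y div (2 * d) \<and> (even x \<longleftrightarrow> odd y)} = d"
proof -
  let ?q = "x div (2 * d)"
  let ?r = "if even x then 1 else 0 :: nat"
  \<comment> \<open>The block starts at the even number \<open>?q * (2 * d)\<close>;
    \<open>?r\<close> selects the parity opposite to \<open>x\<close>.\<close>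
  have "bij_betw (\<lambda>i. ?q * (2 * d) + 2 * i + ?r) {..<d} {y. ?q = y div (2 * d) \<and> (even x \<longleftrightarrow> odd y)}"
  proof (rule bij_betw_imageI)
    show "inj_on (\<lambda>i. ?q * (2 * d) + 2 * i + ?r) {..<d}" by (rule inj_onI) simp
    show "(\<lambda>i. ?q * (2 * d) + 2 * i + ?r) ` {..<d} = {y. ?q = y div (2 * d) \<and> (even x \<longleftrightarrow> odd y)}"
    proof (intro equalityI subsetI)
      fix y assume "y \<in> (\<lambda>i. ?q * (2 * d) + 2 * i + ?r) ` {..<d}"
      then obtain i where i: "i < d" "y = ?q * (2 * d) + (2 * i + ?r)" by auto
      have "2 * i + ?r < 2 * d" using i(1) by auto
      then have "y div (2 * d) = ?q" using i(2) assms by simp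
      moreover have "odd y \<longleftrightarrow> even x" using i(2) by auto
      ultimately show "y \<in> {y. ?q = y div (2 * d) \<and> (even x \<longleftrightarrow> odd y)}" by auto
    next
      fix y assume "y \<in> {y. ?q = y div (2 * d) \<and> (even x \<longleftrightarrow> odd y)}"
      then have y: "?q = y div (2 * d)" "even x \<longleftrightarrow> odd y" by auto
      let ?s = "y mod (2 * d)"
      have s: "y = ?q * (2 * d) + ?s" unfolding y(1) by (rule div_mult_mod_eq[symmetric])
      have "even ?s \<longleftrightarrow> even y" by (simp add: dvd_mod_iff)
      then have "?s = 2 * (?s div 2) + ?r" using y(2) by (auto elim: oddE evenE)
      moreover have "?s div 2 < d" using assms by (simp add: less_mult_imp_div_less mult.commute)
      ultimately show "y \<in> (\<lambda>i. ?q * (2 * d) + 2 * i + ?r) ` {..<d}"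
        using s by (intro image_eqI[of _ _ "?s div 2"]) auto
    qed
  qed
  then show "card {y. ?q = y div (2 * d) \<and> (even x \<longleftrightarrow> odd y)} = d"
    using bij_betw_same_card by fastforce
qed

text \<open>Divisibility of \<open>p\<close> by the block length keeps the block of \<open>x\<close>
  entirely below \<open>p\<close>.\<close>

lemma extremal_nbrs_low:
  assumes "x < p" "0 < d \<longrightarrow> 2 * d dvd p"
  shows "extremal_arcs d p n `` {x} =
    {p..<n} \<union> (if d = 0 then {} else {y. x div (2 * d) = y div (2 * d) \<and> (even x \<longleftrightarrow> odd y)})"
    and "0 < d \<Longrightarrow> {y. x div (2 * d) = y div (2 * d) \<and> (even x \<longleftrightarrow> odd y)} \<subseteq> {..<p}"
proof -
  let ?B = "{y. x div (2 * d) = y div (2 * d) \<and> (even x \<longleftrightarrow> odd y)}"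
  show B: "?B \<subseteq> {..<p}" if d: "0 < d"
  proof
    fix y assume "y \<in> ?B"
    then have q: "y div (2 * d) = x div (2 * d)" by auto
    obtain m where m: "p = 2 * d * m" using assms(2) d by blast
    have "x div (2 * d) < m" using assms(1) m by (simp add: less_mult_imp_div_less mult.commute)
    then have "y div (2 * d) < m" using q by simp
    then have "y < m * (2 * d)" using d by (simp add: div_less_iff_less_mult)
    then show "y \<in> {..<p}" using m by (simp add: mult.commute)
  qed
  show "extremal_arcs d p n `` {x} = {p..<n} \<union> (if d = 0 then {} else ?B)"
    using B assms(1) by (auto simp: extremal_arcs_def)
qed

lemma extremal_nbrs_high:
  assumes "p \<le> x" "x < n"
  shows "extremal_arcs d p n `` {x} = {..<p}"
  using assms by (auto simp: extremal_arcs_def)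

lemma pair_graph_extremal:
  assumes "p \<le> n"
  shows "pair_graph \<lparr>pverts = {..<n}, parcs = extremal_arcs d p n\<rparr>"
  using assms by (auto simp: pair_graph_iff extremal_arcs_def sym_def irrefl_def)

lemma card_extremal_arcs:
  assumes "p \<le> n" "0 < d \<longrightarrow> 2 * d dvd p"
  shows "card (extremal_arcs d p n) = 2 * (p * (n - p)) + d * p"
proof -
  let ?E = "extremal_arcs d p n"
  have low: "card (?E `` {x}) = n - p + d" if "x < p" for x
  proof (cases "d = 0")
    case True
    then show ?thesis using extremal_nbrs_low(1)[OF that assms(2)] by simp
  next
    case False
    let ?B = "{y. x div (2 * d) = y div (2 * d) \<and> (even x \<longleftrightarrow> odd y)}"
    have B: "?B \<subseteq> {..<p}" using extremal_nbrs_low(2)[OF that assms(2)] False by simp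
    then have "finite ?B" using finite_lessThan by (rule finite_subset)
    moreover have "{p..<n} \<inter> ?B = {}"
    proof -
      have "{p..<n} \<inter> {..<p} = {}" by auto
      then show ?thesis using B by blast
    qed
    ultimately have "card ({p..<n} \<union> ?B) = card {p..<n} + card ?B"
      by (intro card_Un_disjoint) auto
    moreover have "card ?B = d" using False by (intro card_block_neighbours) simp
    ultimately show ?thesis using extremal_nbrs_low(1)[OF that assms(2)] False by simp
  qed
  have sub: "?E \<subseteq> {..<n} \<times> {..<n}" using assms(1) by (auto simp: extremal_arcs_def)
  then have "?E = ?E \<inter> {..<n} \<times> {..<n}" by blast
  then have "card ?E = arcs_between ?E {..<n} {..<n}" by (simp add: arcs_between_def)
  also have "\<dots> = (\<Sum>x<n. card (?E `` {x}))"
  proof -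
    have "?E `` {x} \<inter> {..<n} = ?E `` {x}" for x using sub by auto
    then show ?thesis by (simp add: arcs_between_sum)
  qed
  also have "\<dots> = (\<Sum>x\<in>{..<p} \<union> {p..<n}. card (?E `` {x}))"
    using assms(1) by (simp add: ivl_disj_un)
  also have "\<dots> = (\<Sum>x<p. card (?E `` {x})) + (\<Sum>x\<in>{p..<n}. card (?E `` {x}))"
    by (intro sum.union_disjoint) auto
  also have "(\<Sum>x<p. card (?E `` {x})) = p * (n - p + d)" using low by simp
  also have "(\<Sum>x\<in>{p..<n}. card (?E `` {x})) = (n - p) * p"
    using extremal_nbrs_high by simp
  finally show ?thesis by (simp add: algebra_simps)
qed

text \<open>A vertex \<open>v \<ge> p\<close> sees only the blocks, and the connected
  \<open>T\<close> does not fit into one block of \<open>2 * d\<close> vertices. For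
  \<open>v < p\<close> the neighbourhood is bipartite between \<open>{p..<n}\<close> and
  \<open>d\<close> vertices of one parity (none if \<open>d = 0\<close>), too few for a color
  class.\<close>

lemma extremal_free:
  assumes T: "undirected_tree T" and col: "proper_2_coloring T A B"
    and AB: "d < card A" "d < card B" and dvd: "0 < d \<longrightarrow> 2 * d dvd p" and v: "v < n"
  shows "\<not> embeds (pverts T) (parcs T) (extremal_arcs d p n `` {v}) (extremal_arcs d p n)"
proof
  let ?E = "extremal_arcs d p n" and ?F = "parcs T"
  assume "embeds (pverts T) ?F (?E `` {v}) ?E"
  then obtain h where h: "inj_on h (pverts T)" "h ` pverts T \<subseteq> ?E `` {v}"
    "\<forall>u \<in> pverts T. \<forall>w \<in> pverts T. (u, w) \<in> ?F \<longrightarrow> (h u, h w) \<in> ?E"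
    by (rule embedsE)
  have gT: "finite (pverts T)" "?F \<subseteq> pverts T \<times> pverts T"
    using T by (auto simp: undirected_tree_def pair_graph_iff)
  have ne: "pverts T \<noteq> {}" and conn: "\<And>x y. x \<in> pverts T \<Longrightarrow> y \<in> pverts T \<Longrightarrow> (x, y) \<in> ?F\<^sup>*"
    using T connected_iff_rtrancl by (auto simp: undirected_tree_def)
  have hE: "(h u, h w) \<in> ?E" if "(u, w) \<in> ?F" for u w
    using h(3) gT(2) that by blast
  have AB': "A \<union> B = pverts T" "A \<inter> B = {}"
    and ed: "\<And>u w. (u, w) \<in> ?F \<Longrightarrow> u \<in> A \<longleftrightarrow> w \<notin> A"
    using col by (auto simp: proper_2_coloring_def)
  have cT: "card (pverts T) = card A + card B"
    using gT(1) AB' card_Un_disjoint by (metis finite_Un)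
  obtain r where r: "r \<in> pverts T" using ne by blast
  show False
  proof (cases "p \<le> v")
    case True
    have low: "h u < p" if "u \<in> pverts T" for u
      using h(2) that extremal_nbrs_high[OF True v, of d] by blast
    \<comment> \<open>For \<open>d = 0\<close> all block indices agree, but there are no arcs below
      \<open>p\<close>; the disjunct \<open>u = r\<close> records that no step is possible.\<close>
    have "(0 < d \<or> u = r) \<and> h u div (2 * d) = h r div (2 * d)" if "(r, u) \<in> ?F\<^sup>*" for u
      using that
    proof induction
      case (step u w)
      have "u \<in> pverts T" "w \<in> pverts T" using step(2) gT(2) by auto
      then have "h u < p" "h w < p" using low by auto
      then show ?case using hE[OF step(2)] step(3) by (auto simp: extremal_arcs_def)
    qed simp
    then have blk: "0 < d \<or> u = r" "h u div (2 * d) = h r div (2 * d)" if "u \<in> pverts T" for u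
      using conn[OF r that] by blast+
    show False
    proof (cases "d = 0")
      case True
      then have "pverts T \<subseteq> {r}" using blk(1) by auto
      then have "card (pverts T) \<le> card {r}" by (intro card_mono) auto
      then show False using cT AB by simp
    next
      case False
      let ?q = "h r div (2 * d)"
      have "h ` pverts T \<subseteq> {?q * (2 * d)..<?q * (2 * d) + 2 * d}"
      proof
        fix y assume "y \<in> h ` pverts T"
        then have "y div (2 * d) = ?q" using blk(2) by auto
        then have "y = ?q * (2 * d) + y mod (2 * d)" by (metis div_mult_mod_eq)
        moreover have "y mod (2 * d) < 2 * d" using False by simp
        ultimately show "y \<in> {?q * (2 * d)..<?q * (2 * d) + 2 * d}"
          by (metis atLeastLessThan_iff le_add1 nat_add_left_cancel_less)
      qed
      then have "card (h ` pverts T) \<le> card {?q * (2 * d)..<?q * (2 * d) + 2 * d}"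
        by (intro card_mono) auto
      then show False using card_image[OF h(1)] cT AB by simp
    qed
  next
    case False
    then have vp: "v < p" by simp
    let ?B = "{y. v div (2 * d) = y div (2 * d) \<and> (even v \<longleftrightarrow> odd y)}"
    have nb: "d \<noteq> 0 \<and> h u \<in> ?B" if "u \<in> pverts T" "h u < p" for u
    proof -
      have "h u \<in> {p..<n} \<union> (if d = 0 then {} else ?B)"
        using h(2) that(1) extremal_nbrs_low(1)[OF vp dvd, of n] by blast
      then show ?thesis using that(2) by (auto split: if_splits)
    qed
    have flip: "h u < p \<longleftrightarrow> \<not> h w < p" if "(u, w) \<in> ?F" for u w
    proof -
      have uw: "u \<in> pverts T" "w \<in> pverts T" using that gT(2) by auto
      show ?thesis
      proof (cases "h u < p \<and> h w < p")
        case True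
        then have "even (h u) \<longleftrightarrow> even (h w)" using nb[OF uw(1)] nb[OF uw(2)] by blast
        then show ?thesis using True hE[OF that] by (auto simp: extremal_arcs_def)
      next
        case False
        then show ?thesis using hE[OF that] by (auto simp: extremal_arcs_def)
      qed
    qed
    \<comment> \<open>Both \<open>h u < p\<close> and \<open>u \<in> A\<close> change along every
      tree arc, so whether they agree is constant; hence \<open>h\<close> sends exactly one color
      class below \<open>p\<close>.\<close>
    have same: "(h u < p \<longleftrightarrow> u \<in> A) \<longleftrightarrow> (h r < p \<longleftrightarrow> r \<in> A)" if "(r, u) \<in> ?F\<^sup>*" for u
      using that
    proof induction
      case (step u w)
      then show ?case using flip[OF step(2)] ed[OF step(2)] by blast
    qed simp
    let ?L = "{u \<in> pverts T. h u < p}"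
    have "?L = A \<or> ?L = B"
    proof (cases "h r < p \<longleftrightarrow> r \<in> A")
      case True
      then have "h u < p \<longleftrightarrow> u \<in> A" if "u \<in> pverts T" for u using same conn[OF r that] by blast
      then show ?thesis using AB' by blast
    next
      case False
      then have "h u < p \<longleftrightarrow> u \<notin> A" if "u \<in> pverts T" for u using same conn[OF r that] by blast
      then show ?thesis using AB' by blast
    qed
    then have "d < card ?L" using AB by auto
    then have "0 < card ?L" by linarith
    then have "?L \<noteq> {}" unfolding card_gt_0_iff by (rule conjunct1)
    then have d: "0 < d" using nb by blast
    have "finite ?B" using extremal_nbrs_low(2)[OF vp dvd d] finite_lessThan by (rule finite_subset)
    moreover have "h ` ?L \<subseteq> ?B" using nb by blast
    ultimately have "card (h ` ?L) \<le> card ?B" by (intro card_mono)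
    moreover have "card (h ` ?L) = card ?L" using h(1) by (intro card_image inj_on_subset[OF h(1)]) auto
    moreover have "card ?B = d" using d by (rule card_block_neighbours)
    ultimately show False using \<open>d < card ?L\<close> by simp
  qed
qed

text \<open>This order makes \<open>n0 = p\<close> optimal: with \<open>t = x - p\<close> and
  \<open>r = d mod 2\<close>, twice the unrounded value changes by \<open>r * t - 2 * t^2\<close>,
  which is not positive for integers \<open>t\<close>.\<close>

lemma f_bound_le:
  assumes "d = k - 1" "d div 2 \<le> p"
  shows "f_bound (2 * p - d div 2) k \<le> p * (p - d div 2) + (d * p) div 2"
proof -
  let ?c = "d div 2"
  obtain x y where xy: "x + y = 2 * p - ?c" "f_bound (2 * p - ?c) k = x * y + (d * x) div 2"
    using f_bound_attained[of "2 * p - ?c" k] assms(1) by blast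
  let ?t = "int x - int p" and ?r = "int (d mod 2)"
  have y: "int y = int p - int ?c - ?t" using xy(1) assms(2) by linarith
  have d: "int d = 2 * int ?c + ?r"
    by (metis mult_div_mod_eq of_nat_add of_nat_mult of_nat_numeral)
  have "?r * ?t \<le> 2 * (?t * ?t)"
  proof -
    have "?t \<le> ?t * ?t" "0 \<le> ?t * ?t"
      by (cases "?t \<le> 0", auto intro: order_trans[OF _ zero_le_square] simp: mult_le_cancel_left1)
    moreover have "?r = 0 \<or> ?r = 1" by auto
    moreover have "?r * ?t = 0 \<or> ?r * ?t = ?t" using calculation(3) by (elim disjE) simp_all
    ultimately show ?thesis by linarith
  qed
  moreover have "2 * (int x * int y) + int d * int x = 2 * (int p * int p) - 2 * (?t * ?t) + ?r * int p + ?r * ?t"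
    unfolding y d by (simp add: algebra_simps)
  moreover have "2 * (int p * (int p - int ?c)) + int d * int p = 2 * (int p * int p) + ?r * int p"
    unfolding d by (simp add: algebra_simps)
  ultimately have "2 * (int x * int y) + int d * int x \<le> 2 * (int p * (int p - int ?c)) + int d * int p"
    by linarith
  then have "int (2 * (x * y) + d * x) \<le> int (2 * (p * (p - ?c)) + d * p)"
    using assms(2) by (simp add: of_nat_diff)
  then have "(2 * (x * y) + d * x) div 2 \<le> (2 * (p * (p - ?c)) + d * p) div 2"
    by (intro div_le_mono) (simp only: of_nat_le_iff)
  then show ?thesis using xy(2) by simp
qed

theorem theorem1p3:
  fixes k :: nat and T :: "'a pair_pre_digraph"
  assumes "k \<ge> 1"
    and "balanced_tree T"
    and "card (pverts T) = 2 * k \<or> card (pverts T) = 2 * k + 1"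
    and "\<forall>T'. subgraph (with_proj T') (with_proj T) \<and> undirected_tree T' \<longrightarrow> erdos_sos_holds T'"
  shows "(\<forall>n \<ge> 4 * (4 * k) ^ 6. ex_number n (suspension T) \<le> f_bound n k) \<and>
         infinite {n. ex_number n (suspension T) = f_bound n k}"
proof
  obtain A B where T: "undirected_tree T" and col: "proper_2_coloring T A B"
    and bal: "\<bar>int (card A) - int (card B)\<bar> \<le> 1"
    using assms(2) by (auto simp: balanced_tree_def)
  have gT: "pair_graph T" using T by (simp add: undirected_tree_def)
  show upper: "\<forall>n \<ge> 4 * (4 * k) ^ 6. ex_number n (suspension T) \<le> f_bound n k"
    using assms(1,3) by (intro allI impI ex_number_suspension_le[OF _ T _ _ assms(4)]) auto
  let ?d = "k - 1"
  have "finite A" "finite B" "A \<union> B = pverts T" "A \<inter> B = {}"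
    using col gT by (auto simp: proper_2_coloring_def pair_graph_iff intro: finite_subset)
  then have "card (pverts T) = card A + card B" using card_Un_disjoint by metis
  then have cAB: "?d < card A" "?d < card B" using assms(1,3) bal by linarith+
  show "infinite {n. ex_number n (suspension T) = f_bound n k}"
    unfolding infinite_nat_iff_unbounded_le
  proof
    fix N
    define m where "m = N + 4 * (4 * k) ^ 6 + 1"
    \<comment> \<open>A multiple of \<open>2 * ?d\<close> consists of full blocks; without inner
      arcs any \<open>p\<close> will do. Since \<open>m \<le> p \<le> n\<close>, the order
      \<open>n\<close> exceeds both \<open>N\<close> and the threshold.\<close>
    define p where "p = (if ?d = 0 then m else 2 * ?d * m)"
    define n where "n = 2 * p - ?d div 2"
    have dvd: "0 < ?d \<longrightarrow> 2 * ?d dvd p" by (simp add: p_def)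
    have mp: "m \<le> p"
    proof (cases "?d = 0")
      case False
      then have "1 * m \<le> 2 * ?d * m" by (intro mult_le_mono1) simp
      then show ?thesis using False by (simp add: p_def)
    qed (simp add: p_def)
    have dp: "?d div 2 \<le> p"
    proof (cases "?d = 0")
      case False
      then have "?d * 1 \<le> 2 * ?d * m" by (intro mult_le_mono) (simp_all add: m_def)
      then have "?d \<le> p" using False by (simp add: p_def)
      then show ?thesis using div_le_dividend le_trans by blast
    qed simp
    then have pn: "p \<le> n" "n - p = p - ?d div 2" by (auto simp: n_def)
    let ?E = "extremal_arcs ?d p n"
    let ?G = "\<lparr>pverts = {..<n}, parcs = ?E\<rparr>"
    have G: "pair_graph ?G" using pn(1) by (rule pair_graph_extremal)
    have "\<not> contains_copy ?G (suspension T)"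
    proof
      assume "contains_copy ?G (suspension T)"
      from suspension_embeds[OF G gT this]
      obtain v where "v < n" "embeds (pverts T) (parcs T) (?E `` {v}) ?E" by auto
      then show False using extremal_free[OF T col cAB dvd] by blast
    qed
    then have ex: "card (edges ?G) \<le> ex_number n (suspension T)"
      using ex_number_ge[OF G, of n] by simp
    have "2 * card (edges ?G) = 2 * (p * (p - ?d div 2)) + ?d * p"
      using card_parcs[OF G] card_extremal_arcs[OF pn(1) dvd] pn(2) by simp
    then have "card (edges ?G) = p * (p - ?d div 2) + (?d * p) div 2" by linarith
    then have "f_bound n k \<le> card (edges ?G)" using f_bound_le[OF refl dp] by (simp add: n_def)
    moreover have "N \<le> n" "4 * (4 * k) ^ 6 \<le> n" using mp pn(1) by (simp_all add: m_def)
    ultimately show "\<exists>n \<ge> N. n \<in> {n. ex_number n (suspension T) = f_bound n k}"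
      using ex upper by (intro exI[of _ n]) (auto intro: antisym)
  qed
qed

end
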